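(* Let $(Z_t)$ be a continuous-time Markov chain whose states are finite vertex-sets $S \subset \mathbb{Z}^2$, whose possible transitions are $S \to S \cup \{v\}$ where $v$ is a vertex adjacent to $S$, and with $Z_0 = \{\mathbf{0}\}$, where $\mathbf{0}$ is the origin. Assume there are constants $c_*, c^*$ such that for each such transition the rates satisfy \[ 0 < c_* \le q(S, S \cup \{v\}) \le c^* < \infty, \] and assume that whenever $v, v'$ are distinct vertices adjacent to $S$, \[ q(S, S \cup \{v\}) \le q(S \cup \{v'\}, S \cup \{v, v'\}). \] Let $A$ be an arbitrary non-empty subset of $\mathbb{Z}^2 \setminus \{\mathbf{0}\}$, and let $T := \inf\{t : Z_t \cap A \text{ is non-empty}\}$. Then \[ \mathrm{var}\, T \le \mathbb{E} T / c_*. \]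
   Context: $\mathbb{Z}^2$ is the square lattice with nearest-neighbour adjacency. A vertex $v$ is adjacent to $S$ if $v \notin S$ and $v$ is a lattice neighbour of some vertex of $S$. $q(\cdot,\cdot)$ denotes the transition rates of the chain. No spatial homogeneity is assumed. *)

theory Defs
  imports "HOL-Probability.Probability"
begin

section \<open>Continuous-time Markov chains\<close>

text \<open>
  For a process \<open>Z\<close> with right-continuous paths (discrete topology on the states), \<open>jump_time Z n\<close>
  is the time of its \<open>n\<close>-th jump, with value \<open>\<infinity>\<close> if there are fewer than \<open>n\<close> jumps.
\<close>

primrec jump_time :: "(real \<Rightarrow> 'w \<Rightarrow> 's) \<Rightarrow> nat \<Rightarrow> 'w \<Rightarrow> ereal" where
  "jump_time Z 0 \<omega> = 0"
| "jump_time Z (Suc n) \<omega> =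
     Inf {ereal t | t. jump_time Z n \<omega> \<le> ereal t \<and> Z t \<omega> \<noteq> Z (real_of_ereal (jump_time Z n \<omega>)) \<omega>}"

primrec jump_chain :: "(real \<Rightarrow> 'w \<Rightarrow> 's) \<Rightarrow> nat \<Rightarrow> 'w \<Rightarrow> 's" where
  "jump_chain Z 0 \<omega> = Z 0 \<omega>"
| "jump_chain Z (Suc n) \<omega> =
     (if jump_time Z (Suc n) \<omega> = \<infinity> then jump_chain Z n \<omega>
      else Z (real_of_ereal (jump_time Z (Suc n) \<omega>)) \<omega>)"

text \<open>The holding time in state \<open>jump_chain Z n\<close>. Note that \<open>\<infinity> - \<infinity> = \<infinity>\<close> in \<^typ>\<open>ereal\<close>.\<close>

definition holding_time :: "(real \<Rightarrow> 'w \<Rightarrow> 's) \<Rightarrow> nat \<Rightarrow> 'w \<Rightarrow> ereal" where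
  "holding_time Z n \<omega> = jump_time Z (Suc n) \<omega> - jump_time Z n \<omega>"

text \<open>Rates are given by the off-diagonal values of \<open>q\<close>; the values \<open>q x x\<close> are never used.\<close>

definition exit_rate :: "'s set \<Rightarrow> ('s \<Rightarrow> 's \<Rightarrow> real) \<Rightarrow> 's \<Rightarrow> real" where
  "exit_rate I q x = (\<Sum>\<^sub>\<infinity>y\<in>I - {x}. q x y)"

definition jump_prob :: "'s set \<Rightarrow> ('s \<Rightarrow> 's \<Rightarrow> real) \<Rightarrow> 's \<Rightarrow> 's \<Rightarrow> real" where
  "jump_prob I q x y =
     (if exit_rate I q x = 0 then (if y = x then 1 else 0)
      else (if y = x then 0 else q x y / exit_rate I q x))"

text \<open>
  \<open>Z\<close> is a continuous-time Markov chain on the countable state space \<open>I\<close> with transition rates \<open>q\<close>,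
  started at \<open>x0\<close>, in the jump chain / holding time sense: the paths are right-continuous step
  functions, the jump chain is a discrete-time Markov chain with transition matrix \<open>jump_prob I q\<close>,
  and given the jump chain the holding times are independent and exponentially distributed, with
  parameter \<open>exit_rate I q x\<close> for the holding time in state \<open>x\<close>. The last conjunct is the joint law
  of jump chain and holding times. Nothing is prescribed after an explosion, so this describes the
  law of \<open>Z\<close> completely only for non-explosive rates, for instance when each jump adds one element
  to a finite set and the exit rates grow at most linearly with the size of the set.
\<close>

definition markov_chain ::
    "'w measure \<Rightarrow> 's set \<Rightarrow> ('s \<Rightarrow> 's \<Rightarrow> real) \<Rightarrow> 's \<Rightarrow> (real \<Rightarrow> 'w \<Rightarrow> 's) \<Rightarrow> bool" where
  "markov_chain M I q x0 Z \<longleftrightarrow>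
     prob_space M \<and>
     (\<forall>t\<ge>0. Z t \<in> measurable M (count_space I)) \<and>
     (\<forall>\<omega>\<in>space M. \<forall>t\<ge>0. \<forall>\<^sub>F s in at_right t. Z s \<omega> = Z t \<omega>) \<and>
     (\<forall>n x (t :: nat \<Rightarrow> real). (\<forall>i\<le>n. x i \<in> I) \<longrightarrow> (\<forall>i<n. 0 \<le> t i) \<longrightarrow>
        measure M {\<omega> \<in> space M. (\<forall>i\<le>n. jump_chain Z i \<omega> = x i) \<and>
                                (\<forall>i<n. ereal (t i) < holding_time Z i \<omega>)} =
        (if x 0 = x0 then 1 else 0) *
        (\<Prod>i<n. jump_prob I q (x i) (x (Suc i)) * exp (- exit_rate I q (x i) * t i)))"

section \<open>The square lattice\<close>

definition lattice_nbr :: "int \<times> int \<Rightarrow> int \<times> int \<Rightarrow> bool" where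
  "lattice_nbr u v \<longleftrightarrow> \<bar>fst u - fst v\<bar> + \<bar>snd u - snd v\<bar> = 1"

definition adjacent :: "int \<times> int \<Rightarrow> (int \<times> int) set \<Rightarrow> bool" where
  "adjacent v S \<longleftrightarrow> v \<notin> S \<and> (\<exists>u\<in>S. lattice_nbr u v)"

text \<open>The value is \<open>\<infinity>\<close> if the process never meets \<open>A\<close>.\<close>

definition hitting_time :: "(real \<Rightarrow> 'w \<Rightarrow> 'a set) \<Rightarrow> 'a set \<Rightarrow> 'w \<Rightarrow> ereal" where
  "hitting_time Z A \<omega> = Inf {ereal t | t. 0 \<le> t \<and> Z t \<omega> \<inter> A \<noteq> {}}"

end

theory Submission
  imports Defs
begin

text \<open>
  Let \<open>h S\<close> be the mean hitting time of \<open>A\<close> from \<open>S\<close>. It is finite, since the distance to a fixed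
  vertex of \<open>A\<close> divided by \<open>c_low\<close> is a supersolution of the equation
  \<open>(\<Sum>v. q S (S \<union> {v}) * (h S - h (S \<union> {v}))) = 1\<close>, and the monotonicity of the rates makes \<open>h\<close>
  antimonotone, by induction on the number of remaining jumps instead of by a coupling. Hence all
  terms of the equation are nonnegative, each drop \<open>h S - h (S \<union> {v})\<close> is at most \<open>1 / c_low\<close>, and
  \<open>(\<Sum>v. q S (S \<union> {v}) * (h S - h (S \<union> {v}))\<^sup>2) \<le> 1 / c_low\<close>. This sum is the rate at which the
  martingale \<open>h (Z t) + t\<close> accumulates variance up to time \<open>T\<close>; here it enters as the induction
  step of the bound \<open>h\<^sup>2 + h / c_low\<close> for the second moment of the hitting time truncated after
  \<open>n\<close> jumps. The upper bound on the rates only serves to exclude that the chain explodes before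
  it meets \<open>A\<close>.
\<close>

section \<open>The boundary of a finite set of lattice points\<close>

text \<open>The chain is given only by joint probabilities of finitely many states and holding
  times. Conditional expectations and martingales are therefore replaced by recursions in the number
  of jumps, each matched with integrals over the events that fix the first states; monotone
  convergence then removes the truncation. Bounded means of the truncated times do not by themselves
  control \<open>T\<close>: infinitely many jumps could fit into a bounded time without meeting
  \<open>A\<close>, and after such an explosion the path is arbitrary. A hit after finitely many
  jumps is therefore proved separately, and only the path up to that jump is inspected. Comparisons
  between sets use the rates and not the jump probabilities, since only the rates are assumed to
  increase with the set.\<close>

lemma adjacent_subset:
  "{v. adjacent v S} \<subseteq> (\<Union>(i, j)\<in>S. {(i + 1, j), (i - 1, j), (i, j + 1), (i, j - 1)})"
proof
  fix v assume "v \<in> {v. adjacent v S}"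
  then obtain i j where u: "(i, j) \<in> S" and "\<bar>i - fst v\<bar> + \<bar>j - snd v\<bar> = 1"
    by (auto simp: adjacent_def lattice_nbr_def)
  then have "v \<in> {(i + 1, j), (i - 1, j), (i, j + 1), (i, j - 1)}"
    by (cases v) (simp, arith)
  with u show "v \<in> (\<Union>(i, j)\<in>S. {(i + 1, j), (i - 1, j), (i, j + 1), (i, j - 1)})" by blast
qed

lemma finite_adjacent: "finite S \<Longrightarrow> finite {v. adjacent v S}"
  by (rule finite_subset[OF adjacent_subset]) auto

lemma card_adjacent_le:
  assumes "finite S"
  shows "card {v. adjacent v S} \<le> 4 * card S"
proof -
  have "card {v. adjacent v S}
    \<le> card (\<Union>(i, j)\<in>S. {(i + 1, j), (i - 1, j), (i, j + 1), (i, j - 1)})"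
    using assms by (intro card_mono adjacent_subset) auto
  also have "\<dots> \<le> (\<Sum>(i, j)\<in>S. card {(i + 1, j), (i - 1, j), (i, j + 1), (i, j - 1)})"
    unfolding case_prod_beta by (rule card_UN_le[OF assms])
  also have "\<dots> \<le> (\<Sum>(i, j)\<in>S. 4)"
    by (intro sum_mono) (auto simp: card_insert_if)
  finally show ?thesis by (simp add: case_prod_beta mult.commute)
qed

lemma adjacent_insert: "adjacent v S \<Longrightarrow> v \<noteq> w \<Longrightarrow> adjacent v (insert w S)"
  by (auto simp: adjacent_def)

section \<open>Distance from a set to a target vertex\<close>

definition lattice_dist :: "int \<times> int \<Rightarrow> int \<times> int \<Rightarrow> nat" where
  "lattice_dist u v = nat (\<bar>fst u - fst v\<bar> + \<bar>snd u - snd v\<bar>)"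

text \<open>It suffices to move one coordinate in which the points differ; \<open>sgn\<close> gives
  the direction.\<close>

lemma lattice_step_towards:
  assumes "u \<noteq> a"
  obtains v where "lattice_nbr u v" "Suc (lattice_dist v a) = lattice_dist u a"
proof -
  define v where "v = (if fst u \<noteq> fst a then (fst u + sgn (fst a - fst u), snd u)
                       else (fst u, snd u + sgn (snd a - snd u)))"
  have "fst u \<noteq> fst a \<or> snd u \<noteq> snd a"
    using assms by (simp add: prod_eq_iff)
  then have "lattice_nbr u v" "Suc (lattice_dist v a) = lattice_dist u a"
    by (auto simp: v_def lattice_nbr_def lattice_dist_def sgn_if)
  then show thesis by (rule that)
qed

definition set_dist :: "int \<times> int \<Rightarrow> (int \<times> int) set \<Rightarrow> nat" where
  "set_dist a S = Min ((\<lambda>u. lattice_dist u a) ` S)"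

lemma set_dist_insert:
  "finite S \<Longrightarrow> S \<noteq> {} \<Longrightarrow> set_dist a (insert v S) = min (lattice_dist v a) (set_dist a S)"
  by (simp add: set_dist_def)

text \<open>Step from a vertex of \<open>S\<close> nearest to \<open>a\<close>: the new vertex is
  closer than every vertex of \<open>S\<close>, hence outside \<open>S\<close>.\<close>

lemma adjacent_towards:
  assumes "finite S" "S \<noteq> {}" "a \<notin> S"
  obtains v where "adjacent v S" "Suc (set_dist a (insert v S)) = set_dist a S"
proof -
  have "set_dist a S \<in> (\<lambda>u. lattice_dist u a) ` S"
    unfolding set_dist_def using assms by (intro Min_in) auto
  then obtain u where u: "u \<in> S" "lattice_dist u a = set_dist a S" by auto
  with assms have "u \<noteq> a" by auto
  from lattice_step_towards[OF this] obtain v where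
    v: "lattice_nbr u v" "Suc (lattice_dist v a) = lattice_dist u a" .
  have "v \<notin> S"
  proof
    assume "v \<in> S"
    then have "set_dist a S \<le> lattice_dist v a"
      unfolding set_dist_def using assms by (intro Min_le) auto
    with v u show False by simp
  qed
  with u v have "adjacent v S" by (auto simp: adjacent_def)
  moreover have "Suc (set_dist a (insert v S)) = set_dist a S"
    using v u assms by (simp add: set_dist_insert)
  ultimately show thesis by (rule that)
qed

section \<open>Moments of the truncated hitting time\<close>

locale growth_rates =
  fixes q :: "(int \<times> int) set \<Rightarrow> (int \<times> int) set \<Rightarrow> real"
    and c_low c_up :: real
    and A :: "(int \<times> int) set"
  assumes c_pos: "0 < c_low"
    and rate_ge: "\<And>S v. finite S \<Longrightarrow> adjacent v S \<Longrightarrow> c_low \<le> q S (insert v S)"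
    and rate_le: "\<And>S v. finite S \<Longrightarrow> adjacent v S \<Longrightarrow> q S (insert v S) \<le> c_up"
    and rate_mono: "\<And>S v v'. finite S \<Longrightarrow> adjacent v S \<Longrightarrow> adjacent v' S \<Longrightarrow> v \<noteq> v' \<Longrightarrow>
           q S (insert v S) \<le> q (insert v' S) (insert v (insert v' S))"
    and A_nonempty: "A \<noteq> {}"
begin

section \<open>Exit rates and jump probabilities\<close>

definition rate :: "(int \<times> int) set \<Rightarrow> real" where
  "rate S = (\<Sum>v | adjacent v S. q S (insert v S))"

definition step :: "(int \<times> int) set \<Rightarrow> int \<times> int \<Rightarrow> real" where
  "step S v = q S (insert v S) / rate S"

text \<open>A finite set misses some lattice point, and a step towards that point is a boundary
  vertex.\<close>

lemma rate_pos:
  assumes "finite S" "S \<noteq> {}"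
  shows "0 < rate S"
proof -
  have "infinite (UNIV :: (int \<times> int) set)" by (simp add: finite_prod)
  then obtain a where "a \<notin> S" using assms(1) ex_new_if_finite by blast
  from adjacent_towards[OF assms this] obtain v where v: "adjacent v S" .
  have "0 < q S (insert w S)" if "adjacent w S" for w
    using c_pos rate_ge[OF assms(1) that] by simp
  then show ?thesis unfolding rate_def
    using v finite_adjacent[OF assms(1)] by (intro sum_pos) blast+
qed

lemma rate_card_le:
  assumes "finite S"
  shows "rate S \<le> 4 * c_up * card S"
proof (cases "S = {}")
  case True
  then show ?thesis by (simp add: rate_def adjacent_def)
next
  case False
  obtain v where "adjacent v S"
    using rate_pos[OF assms False] unfolding rate_def
    by (metis (mono_tags, lifting) empty_Collect_eq less_irrefl sum.empty)
  \<comment> \<open>The sign of \<open>c_up\<close> is not assumed; it follows from the existence of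
    one transition.\<close>
  then have "0 \<le> c_up" using rate_ge rate_le c_pos assms by (meson less_le_trans order.trans less_imp_le)
  have "rate S \<le> (\<Sum>v | adjacent v S. c_up)"
    unfolding rate_def using rate_le assms by (intro sum_mono) auto
  also have "\<dots> = c_up * card {v. adjacent v S}" by simp
  also have "\<dots> \<le> c_up * (4 * card S)"
    using \<open>0 \<le> c_up\<close> card_adjacent_le[OF assms]
    by (intro mult_left_mono) (auto simp flip: of_nat_mult simp del: of_nat_mult)
  finally show ?thesis by (simp add: mult.commute mult.left_commute)
qed

lemma rate_nonneg_at: "finite S \<Longrightarrow> adjacent v S \<Longrightarrow> 0 \<le> q S (insert v S)"
  using rate_ge c_pos by (meson less_imp_le order.trans)

lemma step_nonneg:
  assumes "finite S" "adjacent v S"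
  shows "0 \<le> step S v"
proof -
  have "S \<noteq> {}" using assms by (auto simp: adjacent_def)
  then show ?thesis using assms rate_nonneg_at rate_pos by (simp add: step_def less_imp_le)
qed

lemma sum_step:
  assumes "finite S" "S \<noteq> {}"
  shows "(\<Sum>v | adjacent v S. step S v) = 1"
proof -
  have "(\<Sum>v | adjacent v S. step S v) = rate S / rate S"
    by (simp only: step_def rate_def sum_divide_distrib)
  with rate_pos[OF assms] show ?thesis by simp
qed

lemma rate_step: "finite S \<Longrightarrow> S \<noteq> {} \<Longrightarrow> rate S * step S v = q S (insert v S)"
  using rate_pos[of S] by (simp add: step_def)

text \<open>First-step recursion for the mean of the sum of at most \<open>n\<close> holding times,
  stopped when \<open>A\<close> is met. The pathwise version is \<open>time_to_hit\<close>.\<close>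

primrec mean_upto :: "nat \<Rightarrow> (int \<times> int) set \<Rightarrow> real" where
  "mean_upto 0 S = 0"
| "mean_upto (Suc n) S = (if S \<inter> A \<noteq> {} then 0
     else 1 / rate S + (\<Sum>v | adjacent v S. step S v * mean_upto n (insert v S)))"

text \<open>The second moment of holding time plus remaining time, which are independent given the
  next state: \<open>2 / (rate S)\<^sup>2\<close> is the second moment of the exponential holding
  time, and \<open>2 / rate S\<close> times the remaining mean is the mixed term.\<close>

primrec sq_upto :: "nat \<Rightarrow> (int \<times> int) set \<Rightarrow> real" where
  "sq_upto 0 S = 0"
| "sq_upto (Suc n) S = (if S \<inter> A \<noteq> {} then 0
     else 2 / (rate S)\<^sup>2 + (\<Sum>v | adjacent v S. step S v *
       (2 / rate S * mean_upto n (insert v S) + sq_upto n (insert v S))))"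

text \<open>The probability that the first \<open>n\<close> states of the jump chain, the current
  one included, miss \<open>A\<close>.\<close>

primrec avoid_prob :: "nat \<Rightarrow> (int \<times> int) set \<Rightarrow> real" where
  "avoid_prob 0 S = 1"
| "avoid_prob (Suc n) S = (if S \<inter> A \<noteq> {} then 0
     else (\<Sum>v | adjacent v S. step S v * avoid_prob n (insert v S)))"

lemma mean_upto_nonneg: "finite S \<Longrightarrow> S \<noteq> {} \<Longrightarrow> 0 \<le> mean_upto n S"
  by (induction n arbitrary: S)
     (auto intro!: add_nonneg_nonneg sum_nonneg mult_nonneg_nonneg step_nonneg less_imp_le[OF rate_pos])

lemma sq_upto_nonneg: "finite S \<Longrightarrow> S \<noteq> {} \<Longrightarrow> 0 \<le> sq_upto n S"
  by (induction n arbitrary: S)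
     (auto intro!: add_nonneg_nonneg sum_nonneg mult_nonneg_nonneg step_nonneg less_imp_le[OF rate_pos]
        mean_upto_nonneg divide_nonneg_nonneg)

lemma avoid_prob_nonneg: "finite S \<Longrightarrow> 0 \<le> avoid_prob n S"
  by (induction n arbitrary: S) (auto intro!: sum_nonneg mult_nonneg_nonneg step_nonneg)

lemma avoid_prob_le_1: "finite S \<Longrightarrow> S \<noteq> {} \<Longrightarrow> avoid_prob n S \<le> 1"
proof (induction n arbitrary: S)
  case (Suc n)
  have "(\<Sum>v | adjacent v S. step S v * avoid_prob n (insert v S)) \<le> (\<Sum>v | adjacent v S. step S v * 1)"
    using Suc by (intro sum_mono mult_left_mono step_nonneg) auto
  with Suc show ?case by (simp add: sum_step)
qed simp

lemma mean_upto_mono: "finite S \<Longrightarrow> mean_upto n S \<le> mean_upto (Suc n) S"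
proof (induction n arbitrary: S)
  case 0
  show ?case
  proof (cases "S = {}")
    case True
    \<comment> \<open>Here \<open>rate S\<close> is an empty sum, and division by 0 gives 0.\<close>
    then show ?thesis by (simp add: rate_def adjacent_def)
  next
    case False
    with 0 show ?thesis using mean_upto_nonneg[OF 0 False] mean_upto_nonneg[OF 0 False, of "Suc 0"] by simp
  qed
next
  case (Suc n)
  have "(\<Sum>v | adjacent v S. step S v * mean_upto n (insert v S))
      \<le> (\<Sum>v | adjacent v S. step S v * mean_upto (Suc n) (insert v S))"
    using Suc by (intro sum_mono mult_left_mono step_nonneg) (simp_all del: mean_upto.simps)
  then show ?case unfolding mean_upto.simps(2)[of n S] mean_upto.simps(2)[of "Suc n" S]
    by (simp del: mean_upto.simps)
qed

text \<open>The recursion multiplied by \<open>rate S\<close>. In this form the rates of two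
  different sets can be compared term by term.\<close>

lemma rate_mean_upto:
  assumes "finite S" "S \<noteq> {}" "S \<inter> A = {}"
  shows "(\<Sum>v | adjacent v S. q S (insert v S) * (mean_upto (Suc n) S - mean_upto n (insert v S))) = 1"
proof -
  have "rate S * mean_upto (Suc n) S
      = 1 + (\<Sum>v | adjacent v S. rate S * (step S v * mean_upto n (insert v S)))"
    using assms rate_pos[OF assms(1,2)] by (simp add: distrib_left sum_distrib_left)
  also have "\<dots> = 1 + (\<Sum>v | adjacent v S. q S (insert v S) * mean_upto n (insert v S))"
    using rate_step[OF assms(1,2)] by (simp flip: mult.assoc)
  finally show ?thesis
    by (simp add: right_diff_distrib sum_subtractf rate_def sum_distrib_right del: mean_upto.simps)
qed

text \<open>
  The distance to a fixed vertex of \<open>A\<close>, divided by \<open>c_low\<close>, is a supersolution of the equation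
  for the mean, because it drops by \<open>1 / c_low\<close> at rate at least \<open>c_low\<close>.
\<close>

lemma mean_upto_le_dist:
  assumes "a \<in> A" "finite S" "S \<noteq> {}"
  shows "mean_upto n S \<le> set_dist a S / c_low"
  using assms(2,3)
proof (induction n arbitrary: S)
  case 0
  then show ?case using c_pos by simp
next
  case (Suc n)
  show ?case
  proof (cases "S \<inter> A = {}")
    case False
    then show ?thesis using c_pos by simp
  next
    case True
    with assms have "a \<notin> S" by auto
    from adjacent_towards[OF Suc.prems this] obtain w where
      w: "adjacent w S" "Suc (set_dist a (insert w S)) = set_dist a S" .
    have drop: "0 \<le> q S (insert v S) * (set_dist a S / c_low - set_dist a (insert v S) / c_low)"
      if "adjacent v S" for v
    proof (intro mult_nonneg_nonneg)
      have "real (set_dist a (insert v S)) \<le> set_dist a S"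
        using Suc.prems by (simp add: set_dist_insert)
      then show "0 \<le> set_dist a S / c_low - set_dist a (insert v S) / c_low"
        using c_pos by (simp add: divide_right_mono)
    qed (use that Suc.prems rate_nonneg_at in auto)
    have "real (set_dist a S) = real (set_dist a (insert w S)) + 1" using w(2) by simp
    \<comment> \<open>The distance drops by exactly one at \<open>w\<close>, so the term of
      \<open>w\<close> alone reaches the value 1.\<close>
    then have "1 = c_low * (set_dist a S / c_low - set_dist a (insert w S) / c_low)"
      using c_pos by (simp add: field_simps)
    also have "\<dots> \<le> q S (insert w S) * (set_dist a S / c_low - set_dist a (insert w S) / c_low)"
      using rate_ge[OF Suc.prems(1) w(1)] w c_pos
      by (intro mult_right_mono) (auto simp: divide_right_mono)
    also have "\<dots> \<le> (\<Sum>v | adjacent v S.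
        q S (insert v S) * (set_dist a S / c_low - set_dist a (insert v S) / c_low))"
      using drop w(1) finite_adjacent[OF Suc.prems(1)]
      by (intro member_le_sum[where f = "\<lambda>v. q S (insert v S) * (set_dist a S / c_low - set_dist a (insert v S) / c_low)"]) auto
    also have "\<dots> \<le> (\<Sum>v | adjacent v S.
        q S (insert v S) * (set_dist a S / c_low - mean_upto n (insert v S)))"
      using Suc by (intro sum_mono mult_left_mono rate_nonneg_at) auto
    finally have "(\<Sum>v | adjacent v S.
        q S (insert v S) * (mean_upto (Suc n) S - mean_upto n (insert v S)))
      \<le> (\<Sum>v | adjacent v S.
        q S (insert v S) * (set_dist a S / c_low - mean_upto n (insert v S)))"
      using rate_mean_upto[OF Suc.prems True, of n] by simp
    \<comment> \<open>The terms in \<open>insert v S\<close> agree on both sides and cancel.\<close>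
    then have "rate S * mean_upto (Suc n) S \<le> rate S * (set_dist a S / c_low)"
      by (simp only: right_diff_distrib sum_subtractf rate_def sum_distrib_right diff_le_eq diff_add_cancel)
    then show ?thesis using rate_pos[OF Suc.prems] mult_le_cancel_left_pos by blast
  qed
qed

text \<open>
  The two sides must be truncated at different numbers of jumps: \<open>mean_upto n\<close> itself need not be
  monotone in the set, since filling a hole may decrease the exit rate. With the indices shifted,
  both sides are truncated at the same cardinality of the set.
\<close>

lemma mean_upto_insert_le:
  assumes "finite S" "adjacent w S"
  shows "mean_upto n (insert w S) \<le> mean_upto (Suc n) S"
  using assms
proof (induction n arbitrary: S w)
  case 0
  then have "S \<noteq> {}" by (auto simp: adjacent_def)
  with 0 show ?case using mean_upto_nonneg[of S "Suc 0"] by simp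
next
  case (Suc n)
  let ?S' = "insert w S"
  have ne: "S \<noteq> {}" using Suc.prems by (auto simp: adjacent_def)
  have nn: "0 \<le> mean_upto (Suc (Suc n)) S" using Suc.prems ne mean_upto_nonneg by blast
  show ?case
  proof (cases "?S' \<inter> A = {}")
    case False
    then have "mean_upto (Suc n) ?S' = 0" by simp
    with nn show ?thesis by simp
  next
    case True
    then have SA: "S \<inter> A = {}" by auto
    let ?N = "{v. adjacent v S}" and ?N' = "{v. adjacent v ?S'}"
    let ?h = "mean_upto (Suc n) ?S'"
    have fin: "finite ?N" "finite ?N'" using Suc.prems finite_adjacent by auto
    have wN: "w \<in> ?N" using Suc.prems by simp
    have sub: "?N - {w} \<subseteq> ?N'" using adjacent_insert by blast
    \<comment> \<open>The aim is that this sum, with \<open>?h\<close> in the place of the mean at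
      \<open>S\<close>, is at most 1. The term of \<open>w\<close> vanishes because
      \<open>insert w S\<close> is the very set of \<open>?h\<close>.\<close>
    have "(\<Sum>v\<in>?N. q S (insert v S) * (?h - mean_upto (Suc n) (insert v S)))
        = (\<Sum>v\<in>?N - {w}. q S (insert v S) * (?h - mean_upto (Suc n) (insert v S)))"
      using fin wN by (simp add: sum.remove del: mean_upto.simps)
    also have "\<dots> \<le> (\<Sum>v\<in>?N - {w}. q ?S' (insert v ?S') * (?h - mean_upto n (insert v ?S')))"
    proof (intro sum_mono)
      fix v assume v: "v \<in> ?N - {w}"
      have "mean_upto n (insert w (insert v S)) \<le> mean_upto (Suc n) (insert v S)"
        using Suc.prems v by (intro Suc.IH adjacent_insert) auto
      then have "?h - mean_upto (Suc n) (insert v S) \<le> ?h - mean_upto n (insert v ?S')"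
        by (simp add: insert_commute del: mean_upto.simps)
      then have "q S (insert v S) * (?h - mean_upto (Suc n) (insert v S))
          \<le> q S (insert v S) * (?h - mean_upto n (insert v ?S'))"
        using v Suc.prems rate_nonneg_at by (intro mult_left_mono) auto
      \<comment> \<open>The rate may be increased because the induction hypothesis at
        \<open>?S'\<close> makes the drop nonnegative.\<close>
      also have "\<dots> \<le> q ?S' (insert v ?S') * (?h - mean_upto n (insert v ?S'))"
        using v Suc.prems Suc.IH[of ?S' v] rate_mono[of S v w] sub
        by (intro mult_right_mono) (auto simp del: mean_upto.simps)
      finally show "q S (insert v S) * (?h - mean_upto (Suc n) (insert v S))
          \<le> q ?S' (insert v ?S') * (?h - mean_upto n (insert v ?S'))" .
    qed
    also have "\<dots> \<le> (\<Sum>v\<in>?N'. q ?S' (insert v ?S') * (?h - mean_upto n (insert v ?S')))"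
      using Suc.prems Suc.IH[of ?S'] fin sub
      by (intro sum_mono2 mult_nonneg_nonneg rate_nonneg_at) (auto simp del: mean_upto.simps)
    also have "\<dots> = 1" using rate_mean_upto[of ?S' n] True Suc.prems by auto
    \<comment> \<open>The equations of both sets have the value 1. After cancelling the terms in
      \<open>insert v S\<close>, only \<open>?h\<close> and the mean at \<open>S\<close> are
      compared.\<close>
    also have "\<dots> = (\<Sum>v\<in>?N. q S (insert v S) * (mean_upto (Suc (Suc n)) S - mean_upto (Suc n) (insert v S)))"
      using rate_mean_upto[OF Suc.prems(1) ne SA] by metis
    finally have "rate S * ?h \<le> rate S * mean_upto (Suc (Suc n)) S"
      by (simp add: right_diff_distrib sum_subtractf rate_def sum_distrib_right del: mean_upto.simps)
    then show ?thesis using rate_pos[OF Suc.prems(1) ne] by (simp del: mean_upto.simps)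
  qed
qed

section \<open>The mean hitting time as a limit\<close>

definition mean_hit :: "(int \<times> int) set \<Rightarrow> real" where
  "mean_hit S = lim (\<lambda>n. mean_upto n S)"

lemma mean_upto_tendsto:
  assumes "finite S" "S \<noteq> {}"
  shows "(\<lambda>n. mean_upto n S) \<longlonglongrightarrow> mean_hit S"
proof -
  obtain a where a: "a \<in> A" using A_nonempty by auto
  have "Bseq (\<lambda>n. mean_upto n S)"
    using mean_upto_le_dist[OF a assms] mean_upto_nonneg[OF assms]
    by (intro BseqI'[where K = "set_dist a S / c_low"]) auto
  moreover have "incseq (\<lambda>n. mean_upto n S)"
    using mean_upto_mono[OF assms(1)] by (rule incseq_SucI)
  ultimately show ?thesis
    unfolding mean_hit_def incseq_def
    by (simp add: Bseq_mono_convergent flip: convergent_LIMSEQ_iff)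
qed

lemma mean_upto_le_mean_hit:
  "finite S \<Longrightarrow> S \<noteq> {} \<Longrightarrow> mean_upto n S \<le> mean_hit S"
  by (rule incseq_le[OF incseq_SucI mean_upto_tendsto]) (rule mean_upto_mono)

text \<open>The index shift of \<open>mean_upto_insert_le\<close> disappears in the limit.\<close>

lemma mean_hit_insert_le:
  assumes "finite S" "adjacent v S"
  shows "mean_hit (insert v S) \<le> mean_hit S"
proof -
  have "S \<noteq> {}" using assms by (auto simp: adjacent_def)
  then show ?thesis
    using assms mean_upto_tendsto[of "insert v S"] mean_upto_tendsto[of S]
    by (intro LIMSEQ_le[OF _ LIMSEQ_Suc]) (auto simp del: mean_upto.simps intro: mean_upto_insert_le)
qed

lemma rate_mean_hit:
  assumes "finite S" "S \<noteq> {}" "S \<inter> A = {}"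
  shows "(\<Sum>v | adjacent v S. q S (insert v S) * (mean_hit S - mean_hit (insert v S))) = 1"
proof (rule LIMSEQ_unique)
  show "(\<lambda>n. \<Sum>v | adjacent v S. q S (insert v S) * (mean_upto (Suc n) S - mean_upto n (insert v S)))
    \<longlonglongrightarrow> (\<Sum>v | adjacent v S. q S (insert v S) * (mean_hit S - mean_hit (insert v S)))"
    using assms by (intro tendsto_intros LIMSEQ_Suc mean_upto_tendsto) auto
  show "(\<lambda>n. \<Sum>v | adjacent v S. q S (insert v S) * (mean_upto (Suc n) S - mean_upto n (insert v S)))
    \<longlonglongrightarrow> 1"
    unfolding rate_mean_upto[OF assms] by simp
qed

text \<open>
  This is where \<open>1 / c_low\<close> comes from: the nonnegative terms of \<open>rate_mean_hit\<close> sum up to 1, so each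
  single drop of the mean is at most \<open>1 / c_low\<close>.
\<close>

lemma sum_rate_sq_drop_le:
  assumes "finite S" "S \<noteq> {}" "S \<inter> A = {}"
  shows "(\<Sum>v | adjacent v S. q S (insert v S) * (mean_hit S - mean_hit (insert v S))\<^sup>2) \<le> 1 / c_low"
proof -
  let ?d = "\<lambda>v. mean_hit S - mean_hit (insert v S)"
  have nonneg: "0 \<le> ?d v" "0 \<le> q S (insert v S) * ?d v" if "adjacent v S" for v
    using mean_hit_insert_le[OF assms(1) that] rate_nonneg_at[OF assms(1) that] by auto
  have drop: "?d v \<le> 1 / c_low" if v: "adjacent v S" for v
  proof -
    have "c_low * ?d v \<le> q S (insert v S) * ?d v"
      using rate_ge[OF assms(1) v] nonneg[OF v] by (intro mult_right_mono)
    also have "\<dots> \<le> (\<Sum>v | adjacent v S. q S (insert v S) * ?d v)"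
      using nonneg v finite_adjacent[OF assms(1)]
      by (intro member_le_sum[where f = "\<lambda>v. q S (insert v S) * ?d v"]) auto
    also have "\<dots> = 1" by (rule rate_mean_hit[OF assms])
    finally show ?thesis using c_pos by (simp add: field_simps)
  qed
  \<comment> \<open>One factor of the square stays in the sum of value 1, the other is estimated by
    \<open>1 / c_low\<close>.\<close>
  have "(\<Sum>v | adjacent v S. q S (insert v S) * (?d v)\<^sup>2)
      = (\<Sum>v | adjacent v S. (q S (insert v S) * ?d v) * ?d v)"
    by (simp add: power2_eq_square mult.assoc)
  also have "\<dots> \<le> (\<Sum>v | adjacent v S. (q S (insert v S) * ?d v) * (1 / c_low))"
    using nonneg drop by (intro sum_mono mult_left_mono) auto
  also have "\<dots> = 1 / c_low"
    using rate_mean_hit[OF assms] by (simp flip: sum_divide_distrib)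
  finally show ?thesis .
qed

lemma mean_hit_nonneg: "finite S \<Longrightarrow> S \<noteq> {} \<Longrightarrow> 0 \<le> mean_hit S"
  using mean_upto_le_mean_hit[of S 0] by simp

text \<open>The summand \<open>mean_hit S / c_low\<close> pays for the squared drops: in one jump it
  falls on average by \<open>1 / (rate S * c_low)\<close>, which is just the bound for the mean
  squared drop. The other terms cancel.\<close>

lemma sq_upto_le:
  assumes "finite S" "S \<noteq> {}"
  shows "sq_upto n S \<le> (mean_hit S)\<^sup>2 + mean_hit S / c_low"
  using assms
proof (induction n arbitrary: S)
  case 0
  then show ?case using c_pos mean_hit_nonneg by simp
next
  case (Suc n)
  let ?r = "rate S" and ?h = "mean_hit S" and ?N = "{v. adjacent v S}"
  let ?k = "\<lambda>v. mean_hit (insert v S)"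
  show ?case
  proof (cases "S \<inter> A = {}")
    case False
    then show ?thesis using Suc.prems c_pos mean_hit_nonneg by simp
  next
    case True
    have r: "0 < ?r" using rate_pos Suc.prems by blast
    have drift: "(\<Sum>v\<in>?N. step S v * (?h - ?k v)) = 1 / ?r"
      using rate_mean_hit[OF Suc.prems True] by (simp add: step_def flip: sum_divide_distrib)
    have sq: "(\<Sum>v\<in>?N. step S v * (?h - ?k v)\<^sup>2) \<le> 1 / (?r * c_low)"
      using divide_right_mono[OF sum_rate_sq_drop_le[OF Suc.prems True], of ?r] r
      by (simp add: step_def mult.commute flip: sum_divide_distrib)
    have "(\<Sum>v\<in>?N. step S v * (2 / ?r * mean_upto n (insert v S) + sq_upto n (insert v S)))
      \<le> (\<Sum>v\<in>?N. step S v * (2 / ?r * ?k v + ((?k v)\<^sup>2 + ?k v / c_low)))"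
      using Suc r mean_upto_le_mean_hit
      by (intro sum_mono mult_left_mono add_mono step_nonneg) (auto intro: divide_right_mono)
    \<comment> \<open>Write \<open>?k v\<close> as \<open>?h\<close> minus the drop and sort by
      powers of the drop, whose mean is \<open>drift\<close>.\<close>
    also have "\<dots> = (\<Sum>v\<in>?N. (2 / ?r * ?h + ?h\<^sup>2 + ?h / c_low) * step S v
        - (2 / ?r + 2 * ?h + 1 / c_low) * (step S v * (?h - ?k v)) + step S v * (?h - ?k v)\<^sup>2)"
      by (intro sum.cong) (simp_all add: power2_eq_square algebra_simps)
    also have "\<dots> = (2 / ?r * ?h + ?h\<^sup>2 + ?h / c_low) - (2 / ?r + 2 * ?h + 1 / c_low) * (1 / ?r)
        + (\<Sum>v\<in>?N. step S v * (?h - ?k v)\<^sup>2)"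
      unfolding sum.distrib sum_subtractf sum_distrib_left[symmetric] drift sum_step[OF Suc.prems]
      by simp
    also have "\<dots> \<le> (2 / ?r * ?h + ?h\<^sup>2 + ?h / c_low) - (2 / ?r + 2 * ?h + 1 / c_low) * (1 / ?r)
        + 1 / (?r * c_low)"
      using sq by simp
    \<comment> \<open>The remaining negative term offsets the second moment of the holding time in
      \<open>sq_upto\<close>.\<close>
    also have "\<dots> = ?h\<^sup>2 + ?h / c_low - 2 / ?r\<^sup>2"
      using r c_pos by (simp add: field_simps power2_eq_square)
    finally show ?thesis using True by simp
  qed
qed

text \<open>
  After \<open>i\<close> jumps from \<open>S\<close> the exit rate is at most \<open>4 * c_up * (card S + i)\<close>, so avoiding \<open>A\<close> forever
  with positive probability would make the mean as large as a harmonic series.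
\<close>

lemma avoid_prob_harmonic_le:
  assumes "finite S" "S \<noteq> {}"
  shows "avoid_prob n S * (\<Sum>i<n. 1 / (4 * c_up * (card S + i))) \<le> mean_upto n S"
  using assms
proof (induction n arbitrary: S)
  case 0
  then show ?case by simp
next
  case (Suc n)
  show ?case
  proof (cases "S \<inter> A = {}")
    case False
    then show ?thesis by simp
  next
    case True
    let ?N = "{v. adjacent v S}"
    \<comment> \<open>The harmonic sum shifted by one, which is the sum of the induction hypothesis
      because \<open>insert v S\<close> has one element more.\<close>
    define s where "s = (\<Sum>i<n. 1 / (4 * c_up * (card S + Suc i)))"
    have r: "0 < rate S" "rate S \<le> 4 * c_up * card S"
      using rate_pos rate_card_le Suc.prems by auto
    have "avoid_prob (Suc n) S * (1 / (4 * c_up * card S)) \<le> 1 * (1 / rate S)"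
      using r Suc.prems avoid_prob_le_1[OF Suc.prems, of "Suc n"]
      by (intro mult_mono frac_le) (auto simp del: avoid_prob.simps)
    moreover have "avoid_prob (Suc n) S * s \<le> (\<Sum>v\<in>?N. step S v * mean_upto n (insert v S))"
    proof -
      have "avoid_prob (Suc n) S * s = (\<Sum>v\<in>?N. step S v * (avoid_prob n (insert v S) * s))"
        using True by (simp add: sum_distrib_right mult.assoc)
      also have "\<dots> \<le> (\<Sum>v\<in>?N. step S v * mean_upto n (insert v S))"
      proof (intro sum_mono mult_left_mono step_nonneg)
        fix v assume v: "v \<in> ?N"
        then have "card (insert v S) = Suc (card S)" using Suc.prems by (simp add: adjacent_def)
        then show "avoid_prob n (insert v S) * s \<le> mean_upto n (insert v S)"
          using Suc.IH[of "insert v S"] Suc.prems by (simp add: s_def)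
      qed (use Suc.prems in auto)
      finally show ?thesis .
    qed
    moreover have "(\<Sum>i<Suc n. 1 / (4 * c_up * (card S + i))) = 1 / (4 * c_up * card S) + s"
      unfolding s_def by (subst sum.lessThan_Suc_shift) simp
    ultimately show ?thesis using True by (simp add: distrib_left del: avoid_prob.simps)
  qed
qed

text \<open>The divergent harmonic series is played against the finite mean. For a singleton, as at
  time 0, the sum is a multiple of \<open>harm n\<close>.\<close>

lemma avoid_prob_tendsto_0:
  assumes "card S = 1"
  shows "(\<lambda>n. avoid_prob n S) \<longlonglongrightarrow> 0"
proof -
  have S: "finite S" "S \<noteq> {}" using assms by (auto simp: card_eq_0_iff intro: card_ge_0_finite)
  have "0 < c_up"
    using rate_pos[OF S] rate_card_le[OF S(1)] assms by simp
  have bound: "avoid_prob n S \<le> 4 * c_up * mean_hit S * inverse (harm n)" if "n > 0" for n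
  proof -
    have "(\<Sum>i<n. 1 / (4 * c_up * (card S + i))) = harm n / (4 * c_up)"
      unfolding harm_def assms
      by (simp add: sum_divide_distrib sum.atLeast1_atMost_eq divide_simps mult.commute)
    then have "avoid_prob n S * (harm n / (4 * c_up)) \<le> mean_hit S"
      using avoid_prob_harmonic_le[OF S, of n] mean_upto_le_mean_hit[OF S, of n] by simp
    moreover have "0 < (harm n :: real)" using that by (simp add: harm_pos)
    ultimately show ?thesis using \<open>0 < c_up\<close> by (simp add: field_simps)
  qed
  have "filterlim (harm :: nat \<Rightarrow> real) at_top sequentially"
    by (rule harm_at_top)
  then have "(\<lambda>n. inverse (harm n :: real)) \<longlonglongrightarrow> 0"
    by (rule tendsto_inverse_0_at_top)
  then have "(\<lambda>n. 4 * c_up * mean_hit S * inverse (harm n)) \<longlonglongrightarrow> 4 * c_up * mean_hit S * 0"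
    by (intro tendsto_intros)
  then have lim: "(\<lambda>n. 4 * c_up * mean_hit S * inverse (harm n)) \<longlonglongrightarrow> 0" by simp
  show ?thesis
    by (rule tendsto_sandwich[OF _ _ tendsto_const lim])
       (use bound avoid_prob_nonneg S in \<open>auto intro: eventually_sequentiallyI[of 1]\<close>)
qed

end

section \<open>Moments from exponential tails\<close>

text \<open>Layer-cake formula, for extended values because holding times may be infinite.\<close>

lemma ennreal_power_eq_nn_integral:
  fixes x :: ennreal
  shows "x ^ Suc k = (\<integral>\<^sup>+t. ennreal (Suc k * t ^ k) * indicator {t. 0 \<le> t \<and> ennreal t < x} t \<partial>lborel)"
proof -
  have fin: "(\<integral>\<^sup>+t. ennreal (Suc k * t ^ k) * indicator {t. 0 \<le> t \<and> ennreal t < ennreal r} t \<partial>lborel)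
      = ennreal r ^ Suc k" if "0 \<le> r" for r
  proof -
    \<comment> \<open>The two domains differ only in the null set consisting of
      \<open>r\<close>.\<close>
    have "(\<integral>\<^sup>+t. ennreal (Suc k * t ^ k) * indicator {t. 0 \<le> t \<and> ennreal t < ennreal r} t \<partial>lborel)
      = (\<integral>\<^sup>+t. ennreal (Suc k * t ^ k) * indicator {0..r} t \<partial>lborel)"
      by (rule nn_integral_cong_AE, use AE_lborel_singleton[of r] in eventually_elim)
         (auto simp: indicator_def ennreal_less_iff)
    also have "\<dots> = ennreal (r ^ Suc k - 0 ^ Suc k)"
    proof (intro nn_integral_FTC_Icc)
      fix t :: real
      show "((\<lambda>t. t ^ Suc k) has_real_derivative Suc k * t ^ k) (at t)"
        using DERIV_pow[of "Suc k" t UNIV] by (simp del: power_Suc)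
    qed (use that in auto)
    finally show ?thesis using that by (simp add: ennreal_power del: power_Suc)
  qed
  show ?thesis
  proof (cases x)
    case (real r)
    with fin show ?thesis by simp
  next
    case top
    let ?J = "\<integral>\<^sup>+t. ennreal (Suc k * t ^ k) * indicator {t. 0 \<le> t \<and> ennreal t < x} t \<partial>lborel"
    \<comment> \<open>For infinite \<open>x\<close> the integral exceeds every natural number, by
      the finite case.\<close>
    have bound: "ennreal (real n) \<le> ?J" if "n > 0" for n :: nat
    proof -
      have "real n ^ 1 \<le> real n ^ Suc k" using that by (intro power_increasing) auto
      then have "ennreal (real n) \<le> ennreal (real n) ^ Suc k"
        by (simp add: ennreal_power ennreal_leI del: power_Suc)
      also have "\<dots> = (\<integral>\<^sup>+t. ennreal (Suc k * t ^ k) *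
          indicator {t. 0 \<le> t \<and> ennreal t < ennreal (real n)} t \<partial>lborel)"
        by (rule fin[symmetric]) simp
      also have "\<dots> \<le> ?J"
        using top by (intro nn_integral_mono mult_left_mono) (auto simp: indicator_def)
      finally show ?thesis .
    qed
    have "?J = \<top>"
    proof (cases ?J)
      case (real r)
      obtain n :: nat where "r < n" using reals_Archimedean2 by blast
      with real bound[of n] show ?thesis by (simp add: ennreal_less_iff flip: not_le)
    qed
    with top show ?thesis by simp
  qed
qed

text \<open>Layer cake and Fubini. The weight \<open>g\<close> allows two uses in a row: for a
  product of two holding times, the first one becomes part of the weight of the second.\<close>

lemma (in sigma_finite_measure) nn_integral_exponential_tail:
  fixes f g :: "'a \<Rightarrow> ennreal"
  assumes [measurable]: "f \<in> borel_measurable M" "g \<in> borel_measurable M"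
    and l: "0 < l"
    and tail: "\<And>t. 0 \<le> t \<Longrightarrow>
      (\<integral>\<^sup>+\<omega>. g \<omega> * indicator {\<omega>. ennreal t < f \<omega>} \<omega> \<partial>M) = c * ennreal (exp (- l * t))"
  shows "(\<integral>\<^sup>+\<omega>. g \<omega> * f \<omega> ^ Suc k \<partial>M) = c * ennreal (fact (Suc k) / l ^ Suc k)"
proof -
  interpret pair_sigma_finite M lborel ..
  let ?K = "\<lambda>t :: real. ennreal (Suc k * t ^ k) * indicator {0..} t"
  have "(\<integral>\<^sup>+\<omega>. g \<omega> * f \<omega> ^ Suc k \<partial>M)
      = (\<integral>\<^sup>+\<omega>. (\<integral>\<^sup>+t. ?K t * (g \<omega> * indicator {\<omega>. ennreal t < f \<omega>} \<omega>) \<partial>lborel) \<partial>M)"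
  proof (intro nn_integral_cong)
    fix \<omega>
    have "g \<omega> * f \<omega> ^ Suc k = (\<integral>\<^sup>+t. g \<omega> *
        (ennreal (Suc k * t ^ k) * indicator {t. 0 \<le> t \<and> ennreal t < f \<omega>} t) \<partial>lborel)"
      unfolding ennreal_power_eq_nn_integral by (rule nn_integral_cmult[symmetric]) measurable
    also have "\<dots> = (\<integral>\<^sup>+t. ?K t * (g \<omega> * indicator {\<omega>. ennreal t < f \<omega>} \<omega>) \<partial>lborel)"
      by (intro nn_integral_cong) (auto simp: indicator_def mult_ac)
    finally show "g \<omega> * f \<omega> ^ Suc k
        = (\<integral>\<^sup>+t. ?K t * (g \<omega> * indicator {\<omega>. ennreal t < f \<omega>} \<omega>) \<partial>lborel)" .
  qed
  also have "\<dots> = (\<integral>\<^sup>+t. (\<integral>\<^sup>+\<omega>. ?K t * (g \<omega> * indicator {\<omega>. ennreal t < f \<omega>} \<omega>) \<partial>M) \<partial>lborel)"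
    by (rule Fubini'[symmetric]) measurable
  also have "\<dots> = (\<integral>\<^sup>+t. ?K t * (\<integral>\<^sup>+\<omega>. g \<omega> * indicator {\<omega>. ennreal t < f \<omega>} \<omega> \<partial>M) \<partial>lborel)"
    by (intro nn_integral_cong nn_integral_cmult) measurable
  \<comment> \<open>\<open>erlang_density 0 l\<close> is the exponential density; the factor
    \<open>1 / l\<close> compensates for its normalisation.\<close>
  also have "\<dots> = (\<integral>\<^sup>+t. (c * ennreal (Suc k / l)) * ennreal (erlang_density 0 l t * t ^ k) \<partial>lborel)"
  proof (intro nn_integral_cong)
    fix t
    show "?K t * (\<integral>\<^sup>+\<omega>. g \<omega> * indicator {\<omega>. ennreal t < f \<omega>} \<omega> \<partial>M)
        = (c * ennreal (Suc k / l)) * ennreal (erlang_density 0 l t * t ^ k)"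
    proof (cases "0 \<le> t")
      case True
      have "ennreal (Suc k * t ^ k) * ennreal (exp (- l * t))
          = ennreal (Suc k / l) * ennreal (erlang_density 0 l t * t ^ k)"
        using True l by (simp add: erlang_density_def mult_ac flip: ennreal_mult)
      with True show ?thesis by (simp add: tail mult_ac)
    qed (simp add: erlang_density_def)
  qed
  also have "\<dots> = c * ennreal (Suc k / l) * ennreal (fact k / l ^ k)"
    using nn_integral_erlang_ith_moment[OF l, of 0 k] by (subst nn_integral_cmult) simp_all
  also have "\<dots> = c * ennreal (fact (Suc k) / l ^ Suc k)"
    using l by (simp add: mult.assoc field_simps flip: ennreal_mult)
  finally show ?thesis .
qed

section \<open>Jump times and jump chain\<close>

lemma jump_time_mono: "jump_time Z n \<omega> \<le> jump_time Z (Suc n) \<omega>"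
  by (auto intro!: Inf_greatest)

lemma jump_time_nonneg: "0 \<le> jump_time Z n \<omega>"
proof (induction n)
  case (Suc n)
  from order_trans[OF this jump_time_mono] show ?case .
qed simp

lemma holding_time_nonneg: "0 \<le> holding_time Z n \<omega>"
  unfolding holding_time_def by (rule ereal_diff_positive[OF jump_time_mono])

lemma jump_time_Suc: "jump_time Z (Suc n) \<omega> = jump_time Z n \<omega> + holding_time Z n \<omega>"
proof -
  have "a \<le> b \<Longrightarrow> 0 \<le> a \<Longrightarrow> b = a + (b - a)" for a b :: ereal
    by (cases a; cases b) auto
  then show ?thesis
    unfolding holding_time_def using jump_time_mono[of Z n \<omega>] jump_time_nonneg[of Z n \<omega>] by blast
qed

lemma jump_chain_eq:
  "jump_time Z n \<omega> \<noteq> \<infinity> \<Longrightarrow> jump_chain Z n \<omega> = Z (real_of_ereal (jump_time Z n \<omega>)) \<omega>"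
  by (cases n) auto

text \<open>Comparing with the state \<open>jump_chain Z n\<close> instead of \<open>Z\<close> at a
  random time is what the measurability proof needs. After an infinite jump time both infima are
  taken over the empty set.\<close>

lemma jump_time_Suc_chain:
  "jump_time Z (Suc n) \<omega> = Inf {ereal t | t. jump_time Z n \<omega> \<le> ereal t \<and> Z t \<omega> \<noteq> jump_chain Z n \<omega>}"
  using jump_chain_eq[of Z n \<omega>] by (cases "jump_time Z n \<omega> = \<infinity>") auto

declare jump_time.simps(2) [simp del] jump_chain.simps(2) [simp del]

lemma process_eq_jump_chain:
  assumes "jump_time Z n \<omega> \<le> ereal t" "ereal t < jump_time Z (Suc n) \<omega>"
  shows "Z t \<omega> = jump_chain Z n \<omega>"
proof (rule ccontr)
  assume "Z t \<omega> \<noteq> jump_chain Z n \<omega>"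
  with assms(1) have "jump_time Z (Suc n) \<omega> \<le> ereal t"
    unfolding jump_time_Suc_chain by (auto intro!: Inf_lower)
  with assms(2) show False by simp
qed

text \<open>A time at which \<open>Z\<close> meets \<open>A\<close> lies in none of the first
  \<open>k\<close> holding intervals, so it has passed every jump up to the
  \<open>k\<close>-th.\<close>

lemma hitting_time_eq_jump_time:
  assumes "\<And>j. j < k \<Longrightarrow> jump_chain Z j \<omega> \<inter> A = {}" "jump_chain Z k \<omega> \<inter> A \<noteq> {}"
    and "jump_time Z k \<omega> \<noteq> \<infinity>"
  shows "hitting_time Z A \<omega> = jump_time Z k \<omega>"
proof (rule antisym)
  obtain t where t: "jump_time Z k \<omega> = ereal t" "0 \<le> t"
    using jump_time_nonneg[of Z k \<omega>] assms(3) by (cases "jump_time Z k \<omega>") auto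
  then show "hitting_time Z A \<omega> \<le> jump_time Z k \<omega>"
    unfolding hitting_time_def using assms(2) jump_chain_eq[of Z k \<omega>] by (auto intro!: Inf_lower)
  show "jump_time Z k \<omega> \<le> hitting_time Z A \<omega>"
    unfolding hitting_time_def
  proof (intro Inf_greatest)
    fix s assume "s \<in> {ereal t |t. 0 \<le> t \<and> Z t \<omega> \<inter> A \<noteq> {}}"
    then obtain t where t: "s = ereal t" "0 \<le> t" "Z t \<omega> \<inter> A \<noteq> {}" by auto
    have "i \<le> k \<Longrightarrow> jump_time Z i \<omega> \<le> ereal t" for i
    proof (induction i)
      case (Suc i)
      then have "Z t \<omega> \<noteq> jump_chain Z i \<omega>" using assms(1)[of i] t by auto
      with Suc show ?case using process_eq_jump_chain[of Z i \<omega> t] by fastforce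
    qed (use t in \<open>simp add: zero_ereal_def\<close>)
    then show "jump_time Z k \<omega> \<le> s" using t by simp
  qed
qed

text \<open>At most \<open>n\<close> holding times from the \<open>m\<close>-th state on. The offset
  \<open>m\<close> lets an induction on \<open>n\<close> move along the path; with values in
  \<open>ennreal\<close> no integrability has to be checked.\<close>

primrec time_to_hit ::
    "(real \<Rightarrow> 'w \<Rightarrow> 'a set) \<Rightarrow> 'a set \<Rightarrow> nat \<Rightarrow> nat \<Rightarrow> 'w \<Rightarrow> ennreal" where
  "time_to_hit Z A 0 m \<omega> = 0"
| "time_to_hit Z A (Suc n) m \<omega> = (if jump_chain Z m \<omega> \<inter> A \<noteq> {} then 0
     else e2ennreal (holding_time Z m \<omega>) + time_to_hit Z A n (Suc m) \<omega>)"

primrec avoids :: "(real \<Rightarrow> 'w \<Rightarrow> 'a set) \<Rightarrow> 'a set \<Rightarrow> nat \<Rightarrow> nat \<Rightarrow> 'w \<Rightarrow> ennreal" where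
  "avoids Z A 0 m \<omega> = 1"
| "avoids Z A (Suc n) m \<omega> = (if jump_chain Z m \<omega> \<inter> A \<noteq> {} then 0 else avoids Z A n (Suc m) \<omega>)"

lemma time_to_hit_mono: "time_to_hit Z A n m \<omega> \<le> time_to_hit Z A (Suc n) m \<omega>"
proof (induction n arbitrary: m)
  case (Suc n)
  show ?case
    using add_left_mono[OF Suc[of "Suc m"], of "e2ennreal (holding_time Z m \<omega>)"] by simp
qed simp

lemma avoids_range: "avoids Z A n m \<omega> \<in> {0, 1}"
  by (induction n arbitrary: m) auto

lemma avoids_eq_0D:
  assumes "avoids Z A n m \<omega> = 0"
  obtains k where "k < n" "\<And>j. j < k \<Longrightarrow> jump_chain Z (m + j) \<omega> \<inter> A = {}"
    "jump_chain Z (m + k) \<omega> \<inter> A \<noteq> {}"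
  using assms
proof (induction n arbitrary: m thesis)
  case 0
  then show ?case by simp
next
  case (Suc n)
  show ?case
  proof (cases "jump_chain Z m \<omega> \<inter> A = {}")
    case False
    then show ?thesis by (intro Suc.prems(1)[of 0]) auto
  next
    case True
    with Suc.prems have "avoids Z A n (Suc m) \<omega> = 0" by simp
    from Suc.IH[OF _ this] obtain k where
      k: "k < n" "\<And>j. j < k \<Longrightarrow> jump_chain Z (Suc m + j) \<omega> \<inter> A = {}"
        "jump_chain Z (Suc m + k) \<omega> \<inter> A \<noteq> {}" by blast
    show ?thesis
    proof (rule Suc.prems(1)[of "Suc k"])
      show "jump_chain Z (m + j) \<omega> \<inter> A = {}" if "j < Suc k" for j
        using that True k(2)[of "j - 1"] by (cases j) auto
    qed (use k in auto)
  qed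
qed

lemma e2ennreal_add: "0 \<le> a \<Longrightarrow> 0 \<le> b \<Longrightarrow> e2ennreal (a + b) = e2ennreal a + e2ennreal b"
  by (cases a; cases b) (simp_all add: ennreal_plus)

text \<open>Beyond the first index at which \<open>A\<close> is met the truncation has no effect,
  and the holding times telescope.\<close>

lemma jump_time_plus_time_to_hit:
  assumes "\<And>j. j < k \<Longrightarrow> jump_chain Z (m + j) \<omega> \<inter> A = {}" "jump_chain Z (m + k) \<omega> \<inter> A \<noteq> {}"
    and "k < n"
  shows "e2ennreal (jump_time Z m \<omega>) + time_to_hit Z A n m \<omega> = e2ennreal (jump_time Z (m + k) \<omega>)"
  using assms
proof (induction k arbitrary: m n)
  case 0
  then show ?case by (cases n) auto
next
  case (Suc k)
  then obtain n' where n: "n = Suc n'" "k < n'" by (cases n) auto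
  have "e2ennreal (jump_time Z m \<omega>) + time_to_hit Z A n m \<omega>
      = e2ennreal (jump_time Z (Suc m) \<omega>) + time_to_hit Z A n' (Suc m) \<omega>"
    using Suc.prems(1)[of 0] unfolding jump_time_Suc
    by (simp add: n add.assoc e2ennreal_add jump_time_nonneg holding_time_nonneg)
  also have "\<dots> = e2ennreal (jump_time Z (Suc m + k) \<omega>)"
    using Suc.prems(1)[of "Suc j" for j] Suc.prems(2) n by (intro Suc.IH) (auto)
  finally show ?case by simp
qed

section \<open>Measurability of jump times, jump chain and hitting time\<close>

locale right_continuous_process =
  fixes M :: "'w measure" and I :: "'s set" and Z :: "real \<Rightarrow> 'w \<Rightarrow> 's"
  assumes countable_states: "countable I"
    and measurable_process: "\<And>t. 0 \<le> t \<Longrightarrow> Z t \<in> measurable M (count_space I)"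
    and right_continuous: "\<And>\<omega> t. \<omega> \<in> space M \<Longrightarrow> 0 \<le> t \<Longrightarrow> \<forall>\<^sub>F s in at_right t. Z s \<omega> = Z t \<omega>"
begin

text \<open>Right-continuity keeps the state for a while after each jump. Tail conditions with
  threshold 0 therefore always hold, which is how marginals are read off from the joint law.\<close>

lemma holding_time_pos:
  assumes "\<omega> \<in> space M"
  shows "0 < holding_time Z n \<omega>"
proof (cases "jump_time Z n \<omega>")
  case (real t)
  then have "0 \<le> t" using jump_time_nonneg[of Z n \<omega>] by simp
  from right_continuous[OF assms this] obtain b where
    b: "t < b" "\<And>s. t < s \<Longrightarrow> s < b \<Longrightarrow> Z s \<omega> = Z t \<omega>"
    by (auto simp: eventually_at_right_field)
  have "ereal b \<le> jump_time Z (Suc n) \<omega>"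
    unfolding jump_time.simps real
  proof (intro Inf_greatest)
    fix e assume "e \<in> {ereal s |s. ereal t \<le> ereal s \<and> Z s \<omega> \<noteq> Z (real_of_ereal (ereal t)) \<omega>}"
    then obtain s where s: "e = ereal s" "t \<le> s" "Z s \<omega> \<noteq> Z t \<omega>" by auto
    then have "t < s" by (cases "t = s") auto
    with s b(2)[of s] show "ereal b \<le> e" by force
  qed
  then have "ereal (b - t) \<le> holding_time Z n \<omega>"
    unfolding holding_time_def real by (cases "jump_time Z (Suc n) \<omega>") auto
  with b(1) show ?thesis
    by (metis diff_gt_0_iff_gt ereal_less(2) less_le_trans)
next
  case PInf
  moreover from this have "jump_time Z (Suc n) \<omega> = \<infinity>" using jump_time_mono[of Z n \<omega>] by simp
  ultimately show ?thesis by (simp add: holding_time_def)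
next
  case MInf
  then show ?thesis using jump_time_nonneg[of Z n \<omega>] by simp
qed

text \<open>Replaces real times by countably many. With \<open>max 0\<close> the time is nonnegative
  for every rational, as measurability requires.\<close>

lemma rational_time:
  assumes "\<omega> \<in> space M" "0 \<le> t" "ereal t < u"
  obtains r where "ereal t < ereal (of_rat r)" "ereal (of_rat r) < u" "Z (max 0 (of_rat r)) \<omega> = Z t \<omega>"
proof -
  obtain b where b: "t < b" "\<And>s. t < s \<Longrightarrow> s < b \<Longrightarrow> Z s \<omega> = Z t \<omega>"
    using right_continuous[OF assms(1,2)] by (auto simp: eventually_at_right_field)
  obtain u' where u': "ereal t < ereal u'" "ereal u' < u" using ereal_dense2[OF assms(3)] by auto
  have "t < min b u'" using b u' by simp
  from of_rat_dense[OF this] obtain r where r: "t < of_rat r" "of_rat r < min b u'" by auto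
  show thesis
  proof (rule that[of r])
    show "ereal (of_rat r) < u" using r u'(2) by (auto intro: order.strict_trans[OF _ u'(2)])
    have "max 0 (of_rat r) = (of_rat r :: real)" using r(1) assms(2) by linarith
    then show "Z (max 0 (of_rat r)) \<omega> = Z t \<omega>" using r b(2)[of "of_rat r"] by simp
  qed (use r in simp)
qed

lemma measurable_at_rational [measurable]:
  "Z (max 0 (of_rat r)) \<in> measurable M (count_space I)"
  by (rule measurable_process) simp

text \<open>By right-continuity, the value at time \<open>\<tau>\<close> is the value at all rational times just after \<open>\<tau>\<close>.\<close>

lemma measurable_at_random_time:
  assumes [measurable]: "\<tau> \<in> borel_measurable M" "Y \<in> measurable M (count_space I)"
    and nonneg: "\<And>\<omega>. 0 \<le> \<tau> \<omega>"
  shows "(\<lambda>\<omega>. if \<tau> \<omega> = \<infinity> then Y \<omega> else Z (real_of_ereal (\<tau> \<omega>)) \<omega>) \<in> measurable M (count_space I)"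
    (is "?f \<in> _")
  unfolding measurable_count_space_eq_countable[OF countable_states]
proof (intro conjI ballI)
  show "?f \<in> space M \<rightarrow> I"
    using measurable_space[OF assms(2)] measurable_space[OF measurable_process[OF real_of_ereal_pos[OF nonneg]]]
    by auto
next
  fix a assume "a \<in> I"
  have "?f -` {a} \<inter> space M = {\<omega>\<in>space M. if \<tau> \<omega> = \<infinity> then Y \<omega> = a
     else (\<exists>m::nat. \<forall>r. \<tau> \<omega> < ereal (of_rat r) \<and> ereal (of_rat r) < \<tau> \<omega> + ereal (1 / Suc m) \<longrightarrow>
       Z (max 0 (of_rat r)) \<omega> = a)}" (is "_ = {\<omega>\<in>space M. ?P \<omega>}")
  proof (intro set_eqI)
    fix \<omega>
    have "?f \<omega> = a \<longleftrightarrow> ?P \<omega>" if \<omega>: "\<omega> \<in> space M"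
    proof (cases "\<tau> \<omega>")
      case (real t)
      then have t: "0 \<le> t" using nonneg[of \<omega>] by simp
      show ?thesis
      proof
        assume "?f \<omega> = a"
        then have a: "Z t \<omega> = a" using real by simp
        obtain b where b: "t < b" "\<And>s. t < s \<Longrightarrow> s < b \<Longrightarrow> Z s \<omega> = Z t \<omega>"
          using right_continuous[OF \<omega> t] by (auto simp: eventually_at_right_field)
        obtain m :: nat where m: "1 / Suc m < b - t"
          using b(1) reals_Archimedean[of "b - t"] by (auto simp: inverse_eq_divide)
        have "\<forall>r. \<tau> \<omega> < ereal (of_rat r) \<and> ereal (of_rat r) < \<tau> \<omega> + ereal (1 / Suc m) \<longrightarrow>
          Z (max 0 (of_rat r)) \<omega> = a"
        proof (intro allI impI)
          fix r assume "\<tau> \<omega> < ereal (of_rat r) \<and> ereal (of_rat r) < \<tau> \<omega> + ereal (1 / Suc m)"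
          then have "t < of_rat r" "of_rat r < b" using m by (auto simp: real)
          moreover from this have "max 0 (of_rat r) = (of_rat r :: real)" using t by linarith
          ultimately show "Z (max 0 (of_rat r)) \<omega> = a" using b(2)[of "of_rat r"] a by simp
        qed
        then show "?P \<omega>" using real by auto
      next
        assume "?P \<omega>"
        then obtain m :: nat where m: "\<And>r. ereal t < ereal (of_rat r) \<Longrightarrow>
          ereal (of_rat r) < ereal t + ereal (1 / Suc m) \<Longrightarrow> Z (max 0 (of_rat r)) \<omega> = a"
          using real by auto
        have "ereal t < ereal t + ereal (1 / Suc m)" by simp
        from rational_time[OF \<omega> t this] m show "?f \<omega> = a" using real by force
      qed
    qed (use nonneg[of \<omega>] in auto)
    then show "\<omega> \<in> ?f -` {a} \<inter> space M \<longleftrightarrow> \<omega> \<in> {\<omega>\<in>space M. ?P \<omega>}" by blast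
  qed
  also have "\<dots> \<in> sets M" using \<open>a \<in> I\<close> by measurable
  finally show "?f -` {a} \<inter> space M \<in> sets M" .
qed

text \<open>A joint induction: the next jump time depends on the current state, and the next state
  on that jump time.\<close>

lemma measurable_jump:
  "jump_time Z n \<in> borel_measurable M \<and> jump_chain Z n \<in> measurable M (count_space I)"
proof (induction n)
  case 0
  show ?case using measurable_process[of 0] by (simp cong: measurable_cong)
next
  case (Suc n)
  then have [measurable]: "jump_time Z n \<in> borel_measurable M"
    "jump_chain Z n \<in> measurable M (count_space I)" by auto
  have 1 [measurable]: "jump_time Z (Suc n) \<in> borel_measurable M"
  proof (rule borel_measurableI_less)
    fix y
    have "{\<omega>\<in>space M. jump_time Z (Suc n) \<omega> < y} = {\<omega>\<in>space M. \<exists>r.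
       jump_time Z n \<omega> \<le> ereal (of_rat r) \<and> ereal (of_rat r) < y \<and>
       Z (max 0 (of_rat r)) \<omega> \<noteq> jump_chain Z n \<omega>}" (is "_ = ?R")
    proof (intro set_eqI iffI)
      fix \<omega> assume "\<omega> \<in> {\<omega>\<in>space M. jump_time Z (Suc n) \<omega> < y}"
      then obtain t where \<omega>: "\<omega> \<in> space M" and t: "jump_time Z n \<omega> \<le> ereal t" "ereal t < y"
        "Z t \<omega> \<noteq> jump_chain Z n \<omega>"
        unfolding jump_time_Suc_chain by (auto simp: Inf_less_iff)
      have "0 \<le> ereal t" using jump_time_nonneg t(1) by (rule order_trans)
      then have "0 \<le> t" by simp
      from rational_time[OF \<omega> this t(2)] t \<omega> show "\<omega> \<in> ?R"
        by (smt (verit) less_le mem_Collect_eq order_trans)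
    next
      fix \<omega> assume "\<omega> \<in> ?R"
      then obtain r where \<omega>: "\<omega> \<in> space M" and r: "jump_time Z n \<omega> \<le> ereal (of_rat r)" "ereal (of_rat r) < y"
       "Z (max 0 (of_rat r)) \<omega> \<noteq> jump_chain Z n \<omega>" by auto
      have "0 \<le> ereal (of_rat r)" using jump_time_nonneg r(1) by (rule order_trans)
      then have "max 0 (of_rat r) = (of_rat r :: real)" by simp
      with r \<omega> show "\<omega> \<in> {\<omega>\<in>space M. jump_time Z (Suc n) \<omega> < y}"
        unfolding jump_time_Suc_chain by (auto simp: Inf_less_iff)
    qed
    also have "\<dots> \<in> sets M"
    proof -
      have [measurable]: "Measurable.pred M (\<lambda>\<omega>. Z (max 0 (of_rat r)) \<omega> = jump_chain Z n \<omega>)" for r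
        by (rule measurable_compose_countable'[OF _ \<open>jump_chain Z n \<in> _\<close> countable_states]) measurable
      show ?thesis by measurable
    qed
    finally show "{\<omega>\<in>space M. jump_time Z (Suc n) \<omega> < y} \<in> sets M" .
  qed
  have "jump_chain Z (Suc n) \<in> measurable M (count_space I)"
    using measurable_at_random_time[OF 1 \<open>jump_chain Z n \<in> _\<close> jump_time_nonneg] unfolding jump_chain.simps(2)[symmetric] .
  with 1 show ?case by blast
qed

lemmas measurable_jump_time [measurable] = measurable_jump[THEN conjunct1]
   and measurable_jump_chain [measurable] = measurable_jump[THEN conjunct2]

lemma measurable_holding_time [measurable]: "holding_time Z n \<in> borel_measurable M"
  unfolding holding_time_def by measurable

lemma jump_chain_in_states:
  "\<omega> \<in> space M \<Longrightarrow> jump_chain Z n \<omega> \<in> I"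
  using measurable_space[OF measurable_jump_chain, of \<omega> n] by simp

end

lemma hitting_time_measurable:
  assumes "right_continuous_process M I Z"
  shows "hitting_time Z A \<in> borel_measurable M"
proof (rule borel_measurableI_less)
  interpret right_continuous_process M I Z by fact
  fix y
  have "{\<omega>\<in>space M. hitting_time Z A \<omega> < y} = {\<omega>\<in>space M. \<exists>r.
     0 \<le> ereal (of_rat r) \<and> ereal (of_rat r) < y \<and> Z (max 0 (of_rat r)) \<omega> \<inter> A \<noteq> {}}" (is "_ = ?R")
  proof (intro set_eqI iffI)
    fix \<omega> assume "\<omega> \<in> {\<omega>\<in>space M. hitting_time Z A \<omega> < y}"
    then obtain t where \<omega>: "\<omega> \<in> space M" and t: "0 \<le> t" "ereal t < y" "Z t \<omega> \<inter> A \<noteq> {}"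
      by (auto simp: hitting_time_def Inf_less_iff)
    from rational_time[OF \<omega> t(1,2)] t \<omega> show "\<omega> \<in> ?R"
      by (smt (verit) ereal_less_eq(5) ereal_less(2) less_eq_ereal_def less_ereal.simps(1) mem_Collect_eq)
  next
    fix \<omega> assume "\<omega> \<in> ?R"
    then obtain r where \<omega>: "\<omega> \<in> space M" and r: "0 \<le> ereal (of_rat r)" "ereal (of_rat r) < y"
      "Z (max 0 (of_rat r)) \<omega> \<inter> A \<noteq> {}" by blast
    from r(1) have "max 0 (of_rat r) = (of_rat r :: real)" by simp
    with r have "hitting_time Z A \<omega> \<le> ereal (of_rat r)"
      unfolding hitting_time_def by (auto intro!: Inf_lower)
    with r(2) \<omega> show "\<omega> \<in> {\<omega>\<in>space M. hitting_time Z A \<omega> < y}"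
      by (auto intro: le_less_trans)
  qed
  also have "\<dots> \<in> sets M"
  proof -
    have [measurable]: "Measurable.pred M (\<lambda>\<omega>. Z (max 0 (of_rat r)) \<omega> \<inter> A \<noteq> {})" for r
      by (rule measurable_compose[where f = "Z (max 0 (of_rat r))" and g = "\<lambda>S. S \<inter> A \<noteq> {}",
            OF measurable_at_rational]) simp
    show ?thesis by measurable
  qed
  finally show "{\<omega>\<in>space M. hitting_time Z A \<omega> < y} \<in> sets M" .
qed

section \<open>The law of jump chain and holding times\<close>

locale markov_jump_process =
  fixes M :: "'w measure" and I :: "'s set" and q x0 Z
  assumes chain: "markov_chain M I q x0 Z" and countable: "countable I"
begin

sublocale prob_space M
  using chain by (simp add: markov_chain_def)

sublocale right_continuous_process M I Z
  by standard (use chain countable in \<open>auto simp: markov_chain_def\<close>)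

section \<open>Probabilities and moments on events fixing the first states\<close>

definition path_event :: "nat \<Rightarrow> (nat \<Rightarrow> 's) \<Rightarrow> 'w set" where
  "path_event n x = {\<omega> \<in> space M. \<forall>i\<le>n. jump_chain Z i \<omega> = x i}"

abbreviation holding :: "nat \<Rightarrow> 'w \<Rightarrow> ennreal" where
  "holding n \<omega> \<equiv> e2ennreal (holding_time Z n \<omega>)"

lemma path_event_sets [measurable]:
  assumes "\<And>i. i \<le> n \<Longrightarrow> x i \<in> I"
  shows "path_event n x \<in> sets M"
proof -
  have "{\<omega> \<in> space M. jump_chain Z i \<omega> = x i} \<in> sets M" if "i \<le> n" for i
    using assms[OF that] by measurable
  then have "{\<omega> \<in> space M. \<forall>i\<in>{..n}. jump_chain Z i \<omega> = x i} \<in> sets M"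
    by (intro sets.sets_Collect_finite_All') auto
  then show ?thesis by (simp add: path_event_def atMost_def)
qed

lemma path_eventD: "\<omega> \<in> path_event n x \<Longrightarrow> i \<le> n \<Longrightarrow> jump_chain Z i \<omega> = x i"
  by (simp add: path_event_def)

lemma less_holding_iff: "0 \<le> t \<Longrightarrow> ennreal t < holding n \<omega> \<longleftrightarrow> ereal t < holding_time Z n \<omega>"
  using holding_time_nonneg[of Z n \<omega>] by (cases "holding_time Z n \<omega>") (auto simp: ennreal_less_iff)

lemma holding_pos: "\<omega> \<in> path_event n x \<Longrightarrow> 0 < holding k \<omega>"
  using holding_time_pos[of \<omega> k] less_holding_iff[of 0 k \<omega>] by (simp add: path_event_def zero_ereal_def)

lemma measure_path_holding:
  assumes "\<And>i. i \<le> n \<Longrightarrow> x i \<in> I" "\<And>i. i < n \<Longrightarrow> 0 \<le> t i"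
  shows "prob {\<omega> \<in> path_event n x. \<forall>i<n. ennreal (t i) < holding i \<omega>} =
    (if x 0 = x0 then 1 else 0) *
      (\<Prod>i<n. jump_prob I q (x i) (x (Suc i)) * exp (- exit_rate I q (x i) * t i))"
proof -
  have "{\<omega> \<in> path_event n x. \<forall>i<n. ennreal (t i) < holding i \<omega>} =
      {\<omega> \<in> space M. (\<forall>i\<le>n. jump_chain Z i \<omega> = x i) \<and> (\<forall>i<n. ereal (t i) < holding_time Z i \<omega>)}"
    using assms(2) by (auto simp: path_event_def less_holding_iff)
  then show ?thesis using chain assms unfolding markov_chain_def by simp
qed

lemma measure_path:
  assumes "\<And>i. i \<le> n \<Longrightarrow> x i \<in> I"
  shows "prob (path_event n x) =
    (if x 0 = x0 then 1 else 0) * (\<Prod>i<n. jump_prob I q (x i) (x (Suc i)))"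
proof -
  have "path_event n x = {\<omega> \<in> path_event n x. \<forall>i<n. ennreal 0 < holding i \<omega>}"
    using holding_pos[of _ n x] by auto
  then show ?thesis using measure_path_holding[of n x "\<lambda>_. 0"] assms by simp
qed

lemma measure_path_Suc:
  assumes "\<And>i. i \<le> Suc n \<Longrightarrow> x i \<in> I"
  shows "prob (path_event (Suc n) x) = jump_prob I q (x n) (x (Suc n)) * prob (path_event n x)"
  using assms by (simp add: measure_path)

text \<open>Given the path, the holding times are independent exponentials. Only those with
  \<open>i < n\<close> are covered: for the holding time \<open>n\<close>, the state
  \<open>Suc n\<close> must be fixed too.\<close>

lemma measure_path_holding_factor:
  assumes "\<And>i. i \<le> n \<Longrightarrow> x i \<in> I" "\<And>i. i < n \<Longrightarrow> 0 \<le> t i"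
  shows "prob {\<omega> \<in> path_event n x. \<forall>i<n. ennreal (t i) < holding i \<omega>} =
    prob (path_event n x) * exp (\<Sum>i<n. - exit_rate I q (x i) * t i)"
  using assms by (simp add: measure_path_holding measure_path prod.distrib exp_sum)

lemma emeasure_path_holding_pair:
  assumes "\<And>i. i \<le> n \<Longrightarrow> x i \<in> I" "i < n" "j < n" "i \<noteq> j" "0 \<le> s" "0 \<le> t"
  shows "emeasure M {\<omega> \<in> path_event n x. ennreal s < holding i \<omega> \<and> ennreal t < holding j \<omega>} =
    emeasure M (path_event n x) * ennreal (exp (- exit_rate I q (x i) * s))
      * ennreal (exp (- exit_rate I q (x j) * t))"
proof -
  \<comment> \<open>Threshold 0 makes the conditions on all other holding times void.\<close>
  let ?t = "\<lambda>k. if k = i then s else if k = j then t else 0"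
  have "{\<omega> \<in> path_event n x. ennreal s < holding i \<omega> \<and> ennreal t < holding j \<omega>}
      = {\<omega> \<in> path_event n x. \<forall>k<n. ennreal (?t k) < holding k \<omega>}"
    using assms(2-4) holding_pos[of _ n x] by auto
  moreover have "(\<Sum>k<n. - exit_rate I q (x k) * ?t k)
      = (\<Sum>k<n. (if k = i then - exit_rate I q (x i) * s else 0)
          + (if k = j then - exit_rate I q (x j) * t else 0))"
    using assms(4) by (intro sum.cong) auto
  then have "(\<Sum>k<n. - exit_rate I q (x k) * ?t k)
      = - exit_rate I q (x i) * s + - exit_rate I q (x j) * t"
    using assms(2,3) by (simp add: sum.distrib)
  ultimately have "prob {\<omega> \<in> path_event n x. ennreal s < holding i \<omega> \<and> ennreal t < holding j \<omega>}
      = prob (path_event n x) * exp (- exit_rate I q (x i) * s + - exit_rate I q (x j) * t)"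
    using measure_path_holding_factor[of n x ?t] assms(1,5,6) by simp
  then show ?thesis
    by (simp only: emeasure_eq_measure exp_add ennreal_mult' ennreal_mult'' measure_nonneg exp_ge_zero
        mult_nonneg_nonneg mult.assoc)
qed

lemma emeasure_path_holding:
  assumes "\<And>i. i \<le> n \<Longrightarrow> x i \<in> I" "i < n" "0 \<le> s"
  shows "emeasure M {\<omega> \<in> path_event n x. ennreal s < holding i \<omega>} =
    emeasure M (path_event n x) * ennreal (exp (- exit_rate I q (x i) * s))"
proof -
  let ?t = "\<lambda>k. if k = i then s else 0"
  have "{\<omega> \<in> path_event n x. ennreal s < holding i \<omega>}
      = {\<omega> \<in> path_event n x. \<forall>k<n. ennreal (?t k) < holding k \<omega>}"
    using assms(2) holding_pos[of _ n x] by auto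
  moreover have "(\<Sum>k<n. - exit_rate I q (x k) * ?t k)
      = (\<Sum>k<n. (if k = i then - exit_rate I q (x i) * s else 0))"
    by (intro sum.cong) auto
  then have "(\<Sum>k<n. - exit_rate I q (x k) * ?t k) = - exit_rate I q (x i) * s"
    using assms(2) by simp
  ultimately have "prob {\<omega> \<in> path_event n x. ennreal s < holding i \<omega>}
      = prob (path_event n x) * exp (- exit_rate I q (x i) * s)"
    using measure_path_holding_factor[of n x ?t] assms(1,3) by simp
  then show ?thesis by (simp add: emeasure_eq_measure ennreal_mult')
qed

lemma nn_integral_holding_power:
  assumes "\<And>i. i \<le> n \<Longrightarrow> x i \<in> I" "i < n" "0 < exit_rate I q (x i)"
  shows "(\<integral>\<^sup>+\<omega>. indicator (path_event n x) \<omega> * holding i \<omega> ^ Suc k \<partial>M)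
    = emeasure M (path_event n x) * ennreal (fact (Suc k) / exit_rate I q (x i) ^ Suc k)"
proof (rule nn_integral_exponential_tail)
  have [measurable]: "path_event n x \<in> sets M" using assms(1) by (rule path_event_sets)
  show "indicator (path_event n x) \<in> borel_measurable M" by measurable
  fix t :: real assume t: "0 \<le> t"
  have "(\<integral>\<^sup>+\<omega>. indicator (path_event n x) \<omega> * indicator {\<omega>. ennreal t < holding i \<omega>} \<omega> \<partial>M)
      = (\<integral>\<^sup>+\<omega>. indicator {\<omega> \<in> path_event n x. ennreal t < holding i \<omega>} \<omega> \<partial>M)"
    by (intro nn_integral_cong) (auto simp: indicator_def)
  also have "\<dots> = emeasure M {\<omega> \<in> path_event n x. ennreal t < holding i \<omega>}"
  proof (rule nn_integral_indicator)
    have "{\<omega> \<in> path_event n x. ennreal t < holding i \<omega>}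
      = path_event n x \<inter> {\<omega> \<in> space M. ennreal t < holding i \<omega>}" by (auto simp: path_event_def)
    also have "\<dots> \<in> sets M" by measurable
    finally show "{\<omega> \<in> path_event n x. ennreal t < holding i \<omega>} \<in> sets M" .
  qed
  also have "\<dots> = emeasure M (path_event n x) * ennreal (exp (- exit_rate I q (x i) * t))"
    using assms t by (intro emeasure_path_holding)
  finally show "(\<integral>\<^sup>+\<omega>. indicator (path_event n x) \<omega> * indicator {\<omega>. ennreal t < holding i \<omega>} \<omega> \<partial>M)
      = emeasure M (path_event n x) * ennreal (exp (- exit_rate I q (x i) * t))" .
qed (use assms in auto)

text \<open>The tail lemma is applied to \<open>holding i\<close> on the event that
  \<open>holding j\<close> exceeds \<open>t\<close>, then to \<open>holding j\<close> with
  \<open>holding i\<close> in the weight.\<close>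

lemma nn_integral_holding_pair:
  assumes "\<And>i. i \<le> n \<Longrightarrow> x i \<in> I" "i < n" "j < n" "i \<noteq> j"
    and "0 < exit_rate I q (x i)" "0 < exit_rate I q (x j)"
  shows "(\<integral>\<^sup>+\<omega>. indicator (path_event n x) \<omega> * holding i \<omega> * holding j \<omega> \<partial>M)
    = emeasure M (path_event n x) * ennreal (1 / exit_rate I q (x i)) * ennreal (1 / exit_rate I q (x j))"
proof -
  have [measurable]: "path_event n x \<in> sets M" using assms(1) by (rule path_event_sets)
  have "(\<integral>\<^sup>+\<omega>. indicator (path_event n x) \<omega> * holding i \<omega> * indicator {\<omega>. ennreal t < holding j \<omega>} \<omega> \<partial>M)
      = emeasure M (path_event n x) * ennreal (1 / exit_rate I q (x i)) * ennreal (exp (- exit_rate I q (x j) * t))"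
    (is "?L = _") if t: "0 \<le> t" for t
  proof -
    let ?E = "{\<omega> \<in> path_event n x. ennreal t < holding j \<omega>}"
    have "?L = (\<integral>\<^sup>+\<omega>. indicator ?E \<omega> * holding i \<omega> ^ Suc 0 \<partial>M)"
      by (intro nn_integral_cong) (auto simp: indicator_def)
    also have "\<dots> = (emeasure M (path_event n x) * ennreal (exp (- exit_rate I q (x j) * t)))
        * ennreal (fact (Suc 0) / exit_rate I q (x i) ^ Suc 0)"
    proof (rule nn_integral_exponential_tail)
      have "?E = path_event n x \<inter> {\<omega> \<in> space M. ennreal t < holding j \<omega>}" by (auto simp: path_event_def)
      also have "\<dots> \<in> sets M" by measurable
      finally have E [measurable]: "?E \<in> sets M" .
      show "indicator ?E \<in> borel_measurable M" by measurable
      fix s :: real assume s: "0 \<le> s"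
      have "(\<integral>\<^sup>+\<omega>. indicator ?E \<omega> * indicator {\<omega>. ennreal s < holding i \<omega>} \<omega> \<partial>M)
          = (\<integral>\<^sup>+\<omega>. indicator {\<omega> \<in> path_event n x. ennreal s < holding i \<omega> \<and> ennreal t < holding j \<omega>} \<omega> \<partial>M)"
        by (intro nn_integral_cong) (auto simp: indicator_def)
      also have "\<dots> = emeasure M {\<omega> \<in> path_event n x. ennreal s < holding i \<omega> \<and> ennreal t < holding j \<omega>}"
      proof (rule nn_integral_indicator)
        have "{\<omega> \<in> path_event n x. ennreal s < holding i \<omega> \<and> ennreal t < holding j \<omega>}
          = ?E \<inter> {\<omega> \<in> space M. ennreal s < holding i \<omega>}" by (auto simp: path_event_def)
        also have "\<dots> \<in> sets M" using E by (rule sets.Int) measurable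
        finally show "{\<omega> \<in> path_event n x. ennreal s < holding i \<omega> \<and> ennreal t < holding j \<omega>} \<in> sets M" .
      qed
      also have "\<dots> = emeasure M (path_event n x) * ennreal (exp (- exit_rate I q (x j) * t))
          * ennreal (exp (- exit_rate I q (x i) * s))"
        using assms s t by (subst emeasure_path_holding_pair) (auto simp: mult_ac)
      finally show "(\<integral>\<^sup>+\<omega>. indicator ?E \<omega> * indicator {\<omega>. ennreal s < holding i \<omega>} \<omega> \<partial>M)
          = emeasure M (path_event n x) * ennreal (exp (- exit_rate I q (x j) * t))
          * ennreal (exp (- exit_rate I q (x i) * s))" .
    qed (use assms in auto)
    finally show ?thesis by (simp add: mult_ac)
  qed
  then have "(\<integral>\<^sup>+\<omega>. (indicator (path_event n x) \<omega> * holding i \<omega>) * holding j \<omega> ^ Suc 0 \<partial>M)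
    = (emeasure M (path_event n x) * ennreal (1 / exit_rate I q (x i)))
        * ennreal (fact (Suc 0) / exit_rate I q (x j) ^ Suc 0)"
    using assms by (intro nn_integral_exponential_tail) auto
  then show ?thesis by simp
qed

text \<open>Each impossible successor has probability 0, and there are only countably many
  states.\<close>

lemma AE_path_Suc:
  assumes "\<And>i. i \<le> n \<Longrightarrow> x i \<in> I"
  shows "AE \<omega> in M. \<omega> \<in> path_event n x \<longrightarrow> jump_prob I q (x n) (jump_chain Z (Suc n) \<omega>) \<noteq> 0"
proof -
  have "AE \<omega> in M. \<forall>y\<in>{y\<in>I. jump_prob I q (x n) y = 0}. \<omega> \<notin> path_event (Suc n) (x(Suc n := y))"
    unfolding AE_ball_countable[OF countable_subset[OF Collect_restrict countable]]
  proof
    fix y assume y: "y \<in> {y\<in>I. jump_prob I q (x n) y = 0}"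
    let ?x = "x(Suc n := y)"
    have x: "\<And>i. i \<le> Suc n \<Longrightarrow> ?x i \<in> I" using assms y by auto
    then have "prob (path_event (Suc n) ?x) = 0" using measure_path_Suc[of n ?x] x y by simp
    then have "emeasure M (path_event (Suc n) ?x) = 0" by (simp add: emeasure_eq_measure)
    then show "AE \<omega> in M. \<omega> \<notin> path_event (Suc n) ?x"
      using path_event_sets[of "Suc n" ?x] x by (intro AE_not_in) (auto simp: null_sets_def)
  qed
  with AE_space show ?thesis
  proof eventually_elim
    case (elim \<omega>)
    show ?case
    proof (intro impI notI)
      assume "\<omega> \<in> path_event n x" "jump_prob I q (x n) (jump_chain Z (Suc n) \<omega>) = 0"
      moreover from this have "\<omega> \<in> path_event (Suc n) (x(Suc n := jump_chain Z (Suc n) \<omega>))"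
        by (auto simp: path_event_def le_Suc_eq)
      ultimately show False using elim jump_chain_in_states by blast
    qed
  qed
qed

end

section \<open>The hitting time of a growth process\<close>

locale growth_process =
  growth_rates q c_low c_up A + markov_jump_process M "{S. finite S}" q "{(0, 0)}" Z
  for q c_low c_up A and M :: "'w measure" and Z +
  assumes transitions: "\<And>S S'. finite S \<Longrightarrow> finite S' \<Longrightarrow> S' \<noteq> S \<Longrightarrow>
    \<not> (\<exists>v. adjacent v S \<and> S' = insert v S) \<Longrightarrow> q S S' = 0"
begin

text \<open>Only the finitely many transitions contribute, and adding a vertex outside
  \<open>S\<close> is injective in the vertex.\<close>

lemma exit_rate_eq:
  assumes "finite S"
  shows "exit_rate {S. finite S} q S = rate S"
proof -
  let ?N = "{v. adjacent v S}"
  have "exit_rate {S. finite S} q S = (\<Sum>\<^sub>\<infinity>S'\<in>(\<lambda>v. insert v S) ` ?N. q S S')"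
    unfolding exit_rate_def
  proof (rule infsum_cong_neutral)
    fix S' assume "S' \<in> ({S. finite S} - {S}) - (\<lambda>v. insert v S) ` ?N"
    then show "q S S' = 0" using assms by (intro transitions) auto
  next
    fix S' assume "S' \<in> (\<lambda>v. insert v S) ` ?N - ({S. finite S} - {S})"
    then show "q S S' = 0" using assms by (auto simp: adjacent_def)
  qed simp
  also have "\<dots> = (\<Sum>S'\<in>(\<lambda>v. insert v S) ` ?N. q S S')"
    using finite_adjacent[OF assms] by (intro infsum_finite finite_imageI)
  also have "\<dots> = rate S"
    unfolding rate_def by (subst sum.reindex) (auto simp: inj_on_def adjacent_def)
  finally show ?thesis .
qed

lemma jump_prob_insert:
  assumes "finite S" "adjacent v S"
  shows "jump_prob {S. finite S} q S (insert v S) = step S v"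
proof -
  have "S \<noteq> {}" "insert v S \<noteq> S" using assms(2) by (auto simp: adjacent_def)
  with rate_pos[OF assms(1)] show ?thesis
    by (simp add: jump_prob_def exit_rate_eq[OF assms(1)] step_def)
qed

lemma jump_prob_neq_0D:
  assumes "finite S" "S \<noteq> {}" "finite S'" "jump_prob {S. finite S} q S S' \<noteq> 0"
  shows "\<exists>v. adjacent v S \<and> S' = insert v S"
proof (rule ccontr)
  assume "\<not> ?thesis"
  with assms have "S' = S \<or> q S S' = 0" using transitions by blast
  moreover have "exit_rate {S. finite S} q S \<noteq> 0"
    using rate_pos[OF assms(1,2)] exit_rate_eq[OF assms(1)] by simp
  ultimately have "jump_prob {S. finite S} q S S' = 0" by (auto simp: jump_prob_def)
  with assms(4) show False by simp
qed

text \<open>Finiteness puts the states into the state space, and non-emptiness makes the exit rates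
  positive. A path with an impossible jump has probability 0.\<close>

definition valid_path :: "nat \<Rightarrow> (nat \<Rightarrow> (int \<times> int) set) \<Rightarrow> bool" where
  "valid_path n x \<longleftrightarrow> (\<forall>i\<le>n. finite (x i) \<and> x i \<noteq> {})"

lemma valid_path_extend: "valid_path n x \<Longrightarrow> valid_path (Suc n) (x(Suc n := insert v (x n)))"
  by (auto simp: valid_path_def le_Suc_eq)

lemma valid_pathD: "valid_path n x \<Longrightarrow> i \<le> n \<Longrightarrow> x i \<in> {S. finite S}"
  by (simp add: valid_path_def)

lemma path_event_measurable: "valid_path n x \<Longrightarrow> path_event n x \<in> sets M"
  using valid_pathD by (rule path_event_sets)

text \<open>Total probability over the next state; distinct boundary vertices give distinct sets, so
  at most one summand is nonzero.\<close>

lemma nn_integral_path_split: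
  assumes x: "valid_path n x" and [measurable]: "F \<in> borel_measurable M"
  shows "(\<integral>\<^sup>+\<omega>. indicator (path_event n x) \<omega> * F \<omega> \<partial>M) = (\<Sum>v | adjacent v (x n).
    \<integral>\<^sup>+\<omega>. indicator (path_event (Suc n) (x(Suc n := insert v (x n)))) \<omega> * F \<omega> \<partial>M)"
proof -
  let ?N = "{v. adjacent v (x n)}"
  let ?E = "\<lambda>v. path_event (Suc n) (x(Suc n := insert v (x n)))"
  have fin: "finite (x n)" "x n \<noteq> {}" using x by (auto simp: valid_path_def)
  have [measurable]: "?E v \<in> sets M" for v
    by (rule path_event_measurable[OF valid_path_extend[OF x]])
  have E: "\<omega> \<in> ?E v \<longleftrightarrow> \<omega> \<in> path_event n x \<and> jump_chain Z (Suc n) \<omega> = insert v (x n)" for \<omega> v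
    by (auto simp: path_event_def le_Suc_eq)
  have "AE \<omega> in M. \<omega> \<in> path_event n x \<longrightarrow>
      jump_prob {S. finite S} q (x n) (jump_chain Z (Suc n) \<omega>) \<noteq> 0"
    using valid_pathD[OF x] by (rule AE_path_Suc)
  then have "AE \<omega> in M. indicator (path_event n x) \<omega> * F \<omega> = (\<Sum>v\<in>?N. indicator (?E v) \<omega> * F \<omega>)"
    using AE_space
  proof eventually_elim
    case (elim \<omega>)
    show ?case
    proof (cases "\<omega> \<in> path_event n x")
      case True
      with elim fin jump_chain_in_states[of \<omega> "Suc n"] obtain v where
        v: "adjacent v (x n)" "jump_chain Z (Suc n) \<omega> = insert v (x n)"
        using jump_prob_neq_0D[of "x n" "jump_chain Z (Suc n) \<omega>"] by auto
      have "(\<Sum>w\<in>?N. indicator (?E w) \<omega> * F \<omega>) = (\<Sum>w\<in>?N. if w = v then F \<omega> else 0)"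
        using v True by (intro sum.cong) (auto simp: E indicator_def adjacent_def)
      also have "\<dots> = F \<omega>" using v(1) finite_adjacent[OF fin(1)] by simp
      finally show ?thesis using True by simp
    qed (simp add: E indicator_def)
  qed
  then have "(\<integral>\<^sup>+\<omega>. indicator (path_event n x) \<omega> * F \<omega> \<partial>M)
      = (\<integral>\<^sup>+\<omega>. (\<Sum>v\<in>?N. indicator (?E v) \<omega> * F \<omega>) \<partial>M)"
    by (rule nn_integral_cong_AE)
  also have "\<dots> = (\<Sum>v\<in>?N. \<integral>\<^sup>+\<omega>. indicator (?E v) \<omega> * F \<omega> \<partial>M)"
    by (rule nn_integral_sum) measurable
  finally show ?thesis .
qed

text \<open>
  Weighting the law by such a \<open>g\<close> keeps the Markov property after the first \<open>k\<close> jumps. The weights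
  needed are \<open>1\<close> and, for the mixed terms of the second moment, a single holding time.
\<close>

definition markov_weight :: "nat \<Rightarrow> ('w \<Rightarrow> ennreal) \<Rightarrow> bool" where
  "markov_weight k g \<longleftrightarrow> g \<in> borel_measurable M \<and> (\<forall>n x. k \<le> n \<longrightarrow> valid_path (Suc n) x \<longrightarrow>
     (\<integral>\<^sup>+\<omega>. indicator (path_event (Suc n) x) \<omega> * g \<omega> \<partial>M)
       = ennreal (jump_prob {S. finite S} q (x n) (x (Suc n))) * (\<integral>\<^sup>+\<omega>. indicator (path_event n x) \<omega> * g \<omega> \<partial>M) \<and>
     (\<integral>\<^sup>+\<omega>. indicator (path_event (Suc n) x) \<omega> * g \<omega> * holding n \<omega> \<partial>M)
       = (\<integral>\<^sup>+\<omega>. indicator (path_event (Suc n) x) \<omega> * g \<omega> \<partial>M) * ennreal (1 / rate (x n)))"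

lemma valid_path_rate:
  "valid_path n x \<Longrightarrow> i \<le> n \<Longrightarrow> exit_rate {S. finite S} q (x i) = rate (x i) \<and> 0 < rate (x i)"
  by (simp add: valid_path_def exit_rate_eq rate_pos)

lemma jump_prob_nonneg:
  assumes "finite S" "S \<noteq> {}" "finite S'"
  shows "0 \<le> jump_prob {S. finite S} q S S'"
proof (cases "jump_prob {S. finite S} q S S' = 0")
  case False
  from jump_prob_neq_0D[OF assms this] step_nonneg assms(1) jump_prob_insert show ?thesis by auto
qed simp

lemma emeasure_path_Suc:
  assumes "valid_path (Suc n) x"
  shows "emeasure M (path_event (Suc n) x)
    = ennreal (jump_prob {S. finite S} q (x n) (x (Suc n))) * emeasure M (path_event n x)"
proof -
  have "0 \<le> jump_prob {S. finite S} q (x n) (x (Suc n))"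
    using assms by (intro jump_prob_nonneg) (auto simp: valid_path_def)
  with measure_path_Suc[of n x] valid_pathD[OF assms] show ?thesis
    by (simp add: emeasure_eq_measure ennreal_mult')
qed

lemma markov_weight_1: "markov_weight 0 (\<lambda>_. 1)"
  unfolding markov_weight_def
proof (intro conjI allI impI)
  fix n x assume x: "valid_path (Suc n) x"
  then have x': "valid_path n x" by (simp add: valid_path_def)
  show "(\<integral>\<^sup>+\<omega>. indicator (path_event (Suc n) x) \<omega> * 1 \<partial>M)
    = ennreal (jump_prob {S. finite S} q (x n) (x (Suc n))) * (\<integral>\<^sup>+\<omega>. indicator (path_event n x) \<omega> * 1 \<partial>M)"
    using emeasure_path_Suc[OF x] path_event_measurable[OF x] path_event_measurable[OF x'] by simp
  show "(\<integral>\<^sup>+\<omega>. indicator (path_event (Suc n) x) \<omega> * 1 * holding n \<omega> \<partial>M)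
    = (\<integral>\<^sup>+\<omega>. indicator (path_event (Suc n) x) \<omega> * 1 \<partial>M) * ennreal (1 / rate (x n))"
    using nn_integral_holding_power[of "Suc n" x n 0] valid_pathD[OF x] valid_path_rate[OF x, of n]
      path_event_measurable[OF x] by simp
qed simp

text \<open>From \<open>Suc j\<close> on, \<open>holding j\<close> is covered by the law on the path
  up to \<open>n\<close> and differs from \<open>holding n\<close>, as the pair formula
  requires.\<close>

lemma markov_weight_holding: "markov_weight (Suc j) (holding j)"
  unfolding markov_weight_def
proof (intro conjI allI impI)
  fix n x assume n: "Suc j \<le> n" and x: "valid_path (Suc n) x"
  then have x': "valid_path n x" by (simp add: valid_path_def)
  have H: "(\<integral>\<^sup>+\<omega>. indicator (path_event m x) \<omega> * holding j \<omega> \<partial>M)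
      = emeasure M (path_event m x) * ennreal (1 / rate (x j))" if "valid_path m x" "j < m" for m
    using nn_integral_holding_power[of m x j 0] valid_pathD[OF that(1)] valid_path_rate[OF that(1), of j] that
    by simp
  show "(\<integral>\<^sup>+\<omega>. indicator (path_event (Suc n) x) \<omega> * holding j \<omega> \<partial>M)
    = ennreal (jump_prob {S. finite S} q (x n) (x (Suc n))) * (\<integral>\<^sup>+\<omega>. indicator (path_event n x) \<omega> * holding j \<omega> \<partial>M)"
    using H[OF x] H[OF x'] n emeasure_path_Suc[OF x] by (simp add: mult.assoc)
  show "(\<integral>\<^sup>+\<omega>. indicator (path_event (Suc n) x) \<omega> * holding j \<omega> * holding n \<omega> \<partial>M)
    = (\<integral>\<^sup>+\<omega>. indicator (path_event (Suc n) x) \<omega> * holding j \<omega> \<partial>M) * ennreal (1 / rate (x n))"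
    using H[OF x] nn_integral_holding_pair[of "Suc n" x j n] valid_pathD[OF x] n
      valid_path_rate[OF x, of n] valid_path_rate[OF x, of j] by simp
qed simp

section \<open>Integrals of the truncated hitting time\<close>

lemma measurable_time_to_hit [measurable]: "time_to_hit Z A n m \<in> borel_measurable M"
proof (induction n arbitrary: m)
  case 0
  show ?case by simp
next
  case (Suc n)
  note [measurable] = Suc
  have [measurable]: "Measurable.pred M (\<lambda>\<omega>. jump_chain Z m \<omega> \<inter> A \<noteq> {})"
    by (rule measurable_compose[OF measurable_jump_chain, where g = "\<lambda>S. S \<inter> A \<noteq> {}"]) simp
  show ?case by simp
qed

lemma measurable_avoids [measurable]: "avoids Z A n m \<in> borel_measurable M"
proof (induction n arbitrary: m)
  case 0
  show ?case by simp
next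
  case (Suc n)
  note [measurable] = Suc
  have [measurable]: "Measurable.pred M (\<lambda>\<omega>. jump_chain Z m \<omega> \<inter> A \<noteq> {})"
    by (rule measurable_compose[OF measurable_jump_chain, where g = "\<lambda>S. S \<inter> A \<noteq> {}"]) simp
  show ?case by simp
qed

text \<open>Weight 1 gives the mean; a holding time as weight gives the mixed term of the second
  moment.\<close>

lemma nn_integral_time_to_hit:
  assumes g: "markov_weight k g" and "k \<le> m" "valid_path m x"
  shows "(\<integral>\<^sup>+\<omega>. indicator (path_event m x) \<omega> * g \<omega> * time_to_hit Z A n m \<omega> \<partial>M)
    = (\<integral>\<^sup>+\<omega>. indicator (path_event m x) \<omega> * g \<omega> \<partial>M) * ennreal (mean_upto n (x m))"
  using assms(2,3)
proof (induction n arbitrary: m x)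
  case 0
  then show ?case by simp
next
  case (Suc n)
  have [measurable]: "g \<in> borel_measurable M" using g by (simp add: markov_weight_def)
  note x = Suc.prems(2)
  have fin: "finite (x m)" "x m \<noteq> {}" using x by (auto simp: valid_path_def)
  show ?case
  proof (cases "x m \<inter> A = {}")
    case False
    then have 0: "indicator (path_event m x) \<omega> * g \<omega> * time_to_hit Z A (Suc n) m \<omega> = 0" for \<omega>
      by (auto simp: path_event_def indicator_def)
    show ?thesis unfolding 0 using False by simp
  next
    case True
    let ?N = "{v. adjacent v (x m)}"
    let ?x = "\<lambda>v. x(Suc m := insert v (x m))"
    let ?G = "\<integral>\<^sup>+\<omega>. indicator (path_event m x) \<omega> * g \<omega> \<partial>M"
    \<comment> \<open>The next state is fixed before integrating, since the law of
      \<open>holding m\<close> is available only on paths up to \<open>Suc m\<close>.\<close>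
    have split: "(\<integral>\<^sup>+\<omega>. indicator (path_event (Suc m) (?x v)) \<omega> * (g \<omega> * time_to_hit Z A (Suc n) m \<omega>) \<partial>M)
      = ?G * ennreal (step (x m) v * (1 / rate (x m) + mean_upto n (insert v (x m))))" if v: "v \<in> ?N" for v
    proof -
      have xv: "valid_path (Suc m) (?x v)" by (rule valid_path_extend[OF x])
      note [measurable] = path_event_measurable[OF xv]
      have same: "path_event m (?x v) = path_event m x" by (auto simp: path_event_def)
      have Gv: "(\<integral>\<^sup>+\<omega>. indicator (path_event (Suc m) (?x v)) \<omega> * g \<omega> \<partial>M) = ennreal (step (x m) v) * ?G"
        using g Suc.prems(1) xv v jump_prob_insert[OF fin(1), of v]
        unfolding markov_weight_def by (auto simp: same)
      have Hv: "(\<integral>\<^sup>+\<omega>. indicator (path_event (Suc m) (?x v)) \<omega> * g \<omega> * holding m \<omega> \<partial>M)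
          = (\<integral>\<^sup>+\<omega>. indicator (path_event (Suc m) (?x v)) \<omega> * g \<omega> \<partial>M) * ennreal (1 / rate (x m))"
        using g Suc.prems(1) xv unfolding markov_weight_def by auto
      have Tv: "(\<integral>\<^sup>+\<omega>. indicator (path_event (Suc m) (?x v)) \<omega> * g \<omega> * time_to_hit Z A n (Suc m) \<omega> \<partial>M)
          = (\<integral>\<^sup>+\<omega>. indicator (path_event (Suc m) (?x v)) \<omega> * g \<omega> \<partial>M) * ennreal (mean_upto n (insert v (x m)))"
        using Suc.IH[of "Suc m" "?x v"] xv Suc.prems(1) by (simp add: fun_upd_same del: fun_upd_apply)
      have "(\<integral>\<^sup>+\<omega>. indicator (path_event (Suc m) (?x v)) \<omega> * (g \<omega> * time_to_hit Z A (Suc n) m \<omega>) \<partial>M)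
        = (\<integral>\<^sup>+\<omega>. indicator (path_event (Suc m) (?x v)) \<omega> * g \<omega> * holding m \<omega>
            + indicator (path_event (Suc m) (?x v)) \<omega> * g \<omega> * time_to_hit Z A n (Suc m) \<omega> \<partial>M)"
        using True by (intro nn_integral_cong) (auto simp: path_event_def indicator_def distrib_left)
      also have "\<dots> = ennreal (step (x m) v) * ?G * ennreal (1 / rate (x m))
          + ennreal (step (x m) v) * ?G * ennreal (mean_upto n (insert v (x m)))"
        unfolding Gv[symmetric] Hv[symmetric] Tv[symmetric] by (rule nn_integral_add) measurable
      also have "\<dots> = ?G * ennreal (step (x m) v * (1 / rate (x m) + mean_upto n (insert v (x m))))"
      proof -
        have nonneg: "0 \<le> step (x m) v" "0 \<le> 1 / rate (x m)" "0 \<le> mean_upto n (insert v (x m))"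
          using step_nonneg[OF fin(1), of v] v rate_pos[OF fin] mean_upto_nonneg fin by auto
        show ?thesis
          unfolding ennreal_mult'[OF nonneg(1)] ennreal_plus[OF nonneg(2,3)]
          by (simp only: distrib_left mult_ac)
      qed
      finally show ?thesis .
    qed
    have "(\<integral>\<^sup>+\<omega>. indicator (path_event m x) \<omega> * (g \<omega> * time_to_hit Z A (Suc n) m \<omega>) \<partial>M)
      = (\<Sum>v\<in>?N. ?G * ennreal (step (x m) v * (1 / rate (x m) + mean_upto n (insert v (x m)))))"
      using split by (subst nn_integral_path_split[OF x]) (auto simp del: time_to_hit.simps)
    also have "\<dots> = ?G * ennreal (\<Sum>v\<in>?N. step (x m) v * (1 / rate (x m) + mean_upto n (insert v (x m))))"
      using step_nonneg[OF fin(1)] rate_pos[OF fin] mean_upto_nonneg[of "insert v (x m)" n for v] fin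
      by (subst sum_distrib_left[symmetric], subst sum_ennreal) (auto intro!: mult_nonneg_nonneg add_nonneg_nonneg)
    also have "(\<Sum>v\<in>?N. step (x m) v * (1 / rate (x m) + mean_upto n (insert v (x m)))) = mean_upto (Suc n) (x m)"
      using True sum_step[OF fin] by (simp add: distrib_left sum.distrib flip: sum_divide_distrib)
    finally show ?thesis by (simp add: mult.assoc del: time_to_hit.simps mean_upto.simps)
  qed
qed

lemma nn_integral_avoids:
  assumes "valid_path m x"
  shows "(\<integral>\<^sup>+\<omega>. indicator (path_event m x) \<omega> * avoids Z A n m \<omega> \<partial>M)
    = emeasure M (path_event m x) * ennreal (avoid_prob n (x m))"
  using assms
proof (induction n arbitrary: m x)
  case 0
  then show ?case using path_event_measurable by simp
next
  case (Suc n)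
  note x = Suc.prems
  have fin: "finite (x m)" "x m \<noteq> {}" using x by (auto simp: valid_path_def)
  show ?case
  proof (cases "x m \<inter> A = {}")
    case False
    then have 0: "indicator (path_event m x) \<omega> * avoids Z A (Suc n) m \<omega> = 0" for \<omega>
      by (auto simp: path_event_def indicator_def)
    show ?thesis unfolding 0 using False by simp
  next
    case True
    let ?N = "{v. adjacent v (x m)}"
    let ?x = "\<lambda>v. x(Suc m := insert v (x m))"
    have split: "(\<integral>\<^sup>+\<omega>. indicator (path_event (Suc m) (?x v)) \<omega> * avoids Z A (Suc n) m \<omega> \<partial>M)
      = emeasure M (path_event m x) * ennreal (step (x m) v * avoid_prob n (insert v (x m)))" if v: "v \<in> ?N" for v
    proof -
      have xv: "valid_path (Suc m) (?x v)" by (rule valid_path_extend[OF x])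
      have same: "path_event m (?x v) = path_event m x" by (auto simp: path_event_def)
      have "(\<integral>\<^sup>+\<omega>. indicator (path_event (Suc m) (?x v)) \<omega> * avoids Z A (Suc n) m \<omega> \<partial>M)
        = (\<integral>\<^sup>+\<omega>. indicator (path_event (Suc m) (?x v)) \<omega> * avoids Z A n (Suc m) \<omega> \<partial>M)"
      proof (intro nn_integral_cong)
        fix \<omega>
        from True path_eventD[of \<omega> "Suc m" "?x v" m] show "indicator (path_event (Suc m) (?x v)) \<omega> * avoids Z A (Suc n) m \<omega>
            = indicator (path_event (Suc m) (?x v)) \<omega> * avoids Z A n (Suc m) \<omega>"
          by (auto simp: indicator_def)
      qed
      also have "\<dots> = emeasure M (path_event (Suc m) (?x v)) * ennreal (avoid_prob n (insert v (x m)))"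
        using Suc.IH[of "Suc m" "?x v"] xv by (simp add: fun_upd_same del: fun_upd_apply)
      also have "\<dots> = ennreal (step (x m) v) * emeasure M (path_event m x) * ennreal (avoid_prob n (insert v (x m)))"
        using emeasure_path_Suc[OF xv] jump_prob_insert[OF fin(1), of v] v by (simp add: same)
      also have "\<dots> = emeasure M (path_event m x) * ennreal (step (x m) v * avoid_prob n (insert v (x m)))"
        using step_nonneg[OF fin(1), of v] v by (simp add: ennreal_mult' mult_ac)
      finally show ?thesis .
    qed
    have "(\<integral>\<^sup>+\<omega>. indicator (path_event m x) \<omega> * avoids Z A (Suc n) m \<omega> \<partial>M)
      = (\<Sum>v\<in>?N. emeasure M (path_event m x) * ennreal (step (x m) v * avoid_prob n (insert v (x m))))"
      using split by (subst nn_integral_path_split[OF x]) (auto simp del: avoids.simps)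
    also have "\<dots> = emeasure M (path_event m x) * ennreal (\<Sum>v\<in>?N. step (x m) v * avoid_prob n (insert v (x m)))"
      using step_nonneg[OF fin(1)] avoid_prob_nonneg[of "insert v (x m)" n for v] fin
      by (subst sum_distrib_left[symmetric], subst sum_ennreal) (auto intro!: mult_nonneg_nonneg)
    finally show ?thesis using True by simp
  qed
qed

lemma nn_integral_time_to_hit_sq:
  assumes "valid_path m x"
  shows "(\<integral>\<^sup>+\<omega>. indicator (path_event m x) \<omega> * (time_to_hit Z A n m \<omega>)\<^sup>2 \<partial>M)
    = emeasure M (path_event m x) * ennreal (sq_upto n (x m))"
  using assms
proof (induction n arbitrary: m x)
  case 0
  then show ?case by simp
next
  case (Suc n)
  note x = Suc.prems
  have fin: "finite (x m)" "x m \<noteq> {}" using x by (auto simp: valid_path_def)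
  show ?case
  proof (cases "x m \<inter> A = {}")
    case False
    then have 0: "indicator (path_event m x) \<omega> * (time_to_hit Z A (Suc n) m \<omega>)\<^sup>2 = 0" for \<omega>
      by (auto simp: path_event_def indicator_def)
    show ?thesis unfolding 0 using False by simp
  next
    case True
    let ?N = "{v. adjacent v (x m)}"
    let ?x = "\<lambda>v. x(Suc m := insert v (x m))"
    let ?r = "rate (x m)"
    \<comment> \<open>The second moment of the truncated time given that the next vertex is
      \<open>v\<close>.\<close>
    let ?c = "\<lambda>v. 2 / ?r\<^sup>2 + (2 / ?r * mean_upto n (insert v (x m)) + sq_upto n (insert v (x m)))"
    have r: "0 < ?r" by (rule rate_pos[OF fin])
    have c: "0 \<le> ?c v" for v
      using r mean_upto_nonneg[of "insert v (x m)" n] sq_upto_nonneg[of "insert v (x m)" n] fin by simp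
    have split: "(\<integral>\<^sup>+\<omega>. indicator (path_event (Suc m) (?x v)) \<omega> * (time_to_hit Z A (Suc n) m \<omega>)\<^sup>2 \<partial>M)
      = emeasure M (path_event m x) * ennreal (step (x m) v * ?c v)" if v: "v \<in> ?N" for v
    proof -
      have xv: "valid_path (Suc m) (?x v)" by (rule valid_path_extend[OF x])
      note [measurable] = path_event_measurable[OF xv]
      let ?I = "\<lambda>\<omega>. indicator (path_event (Suc m) (?x v)) \<omega> :: ennreal"
      let ?P = "emeasure M (path_event (Suc m) (?x v))"
      let ?R = "time_to_hit Z A n (Suc m)"
      have same: "path_event m (?x v) = path_event m x" by (auto simp: path_event_def)
      note er = valid_path_rate[OF xv, of m]
      have H: "(\<integral>\<^sup>+\<omega>. ?I \<omega> * holding m \<omega> \<partial>M) = ?P * ennreal (1 / ?r)"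
        using nn_integral_holding_power[of "Suc m" "?x v" m 0] valid_pathD[OF xv] er by simp
      have HH: "(\<integral>\<^sup>+\<omega>. ?I \<omega> * (holding m \<omega>)\<^sup>2 \<partial>M) = ?P * ennreal (2 / ?r\<^sup>2)"
        using nn_integral_holding_power[of "Suc m" "?x v" m 1] valid_pathD[OF xv] er
        by (simp add: power2_eq_square)
      \<comment> \<open>The mixed term: the mean of the remaining time under the weight
        \<open>holding m\<close>.\<close>
      have HR: "(\<integral>\<^sup>+\<omega>. ?I \<omega> * holding m \<omega> * ?R \<omega> \<partial>M)
          = ?P * ennreal (1 / ?r) * ennreal (mean_upto n (insert v (x m)))"
        using nn_integral_time_to_hit[OF markov_weight_holding[of m] _ xv, of n] H by simp
      have RR: "(\<integral>\<^sup>+\<omega>. ?I \<omega> * (?R \<omega>)\<^sup>2 \<partial>M) = ?P * ennreal (sq_upto n (insert v (x m)))"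
        using Suc.IH[of "Suc m" "?x v"] xv by (simp add: fun_upd_same del: fun_upd_apply)
      have "(\<integral>\<^sup>+\<omega>. ?I \<omega> * (time_to_hit Z A (Suc n) m \<omega>)\<^sup>2 \<partial>M)
        = (\<integral>\<^sup>+\<omega>. ?I \<omega> * (holding m \<omega>)\<^sup>2 + (2 * (?I \<omega> * holding m \<omega> * ?R \<omega>) + ?I \<omega> * (?R \<omega>)\<^sup>2) \<partial>M)"
        using True path_eventD[of _ "Suc m" "?x v" m] by (intro nn_integral_cong)
          (auto simp: indicator_def power2_eq_square algebra_simps mult_2)
      also have "\<dots> = ?P * ennreal (2 / ?r\<^sup>2)
          + (2 * (?P * ennreal (1 / ?r) * ennreal (mean_upto n (insert v (x m))))
            + ?P * ennreal (sq_upto n (insert v (x m))))"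
        unfolding HH[symmetric] HR[symmetric] RR[symmetric]
        by (simp add: nn_integral_add nn_integral_cmult)
      also have "\<dots> = ?P * ennreal (?c v)"
      proof -
        have nonneg: "0 \<le> 2 / ?r\<^sup>2" "0 \<le> 1 / ?r" "0 \<le> mean_upto n (insert v (x m))"
            "0 \<le> 2 / ?r * mean_upto n (insert v (x m))" "0 \<le> sq_upto n (insert v (x m))"
          using r mean_upto_nonneg[of "insert v (x m)" n] sq_upto_nonneg[of "insert v (x m)" n] fin by auto
        have "ennreal (2 / ?r * mean_upto n (insert v (x m)))
            = ennreal 2 * (ennreal (1 / ?r) * ennreal (mean_upto n (insert v (x m))))"
          using nonneg by (simp flip: ennreal_mult' del: ennreal_numeral)
        then have c_eq: "ennreal (?c v) = ennreal (2 / ?r\<^sup>2)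
            + (2 * (ennreal (1 / ?r) * ennreal (mean_upto n (insert v (x m)))) + ennreal (sq_upto n (insert v (x m))))"
          using nonneg by (simp add: ennreal_plus)
        show ?thesis unfolding c_eq by (simp only: distrib_left mult_ac)
      qed
      also have "?P = ennreal (step (x m) v) * emeasure M (path_event m x)"
        using emeasure_path_Suc[OF xv] jump_prob_insert[OF fin(1), of v] v by (simp add: same)
      also have "\<dots> * ennreal (?c v) = emeasure M (path_event m x) * ennreal (step (x m) v * ?c v)"
        unfolding ennreal_mult'[OF step_nonneg[OF fin(1), of v], simplified, OF v[simplified]]
          by (simp only: mult_ac)
      finally show ?thesis .
    qed
    have "(\<integral>\<^sup>+\<omega>. indicator (path_event m x) \<omega> * (time_to_hit Z A (Suc n) m \<omega>)\<^sup>2 \<partial>M)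
      = (\<Sum>v\<in>?N. emeasure M (path_event m x) * ennreal (step (x m) v * ?c v))"
      using split by (subst nn_integral_path_split[OF x]) (auto simp del: time_to_hit.simps)
    also have "\<dots> = emeasure M (path_event m x) * ennreal (\<Sum>v\<in>?N. step (x m) v * ?c v)"
      using step_nonneg[OF fin(1)] c
      by (subst sum_distrib_left[symmetric], subst sum_ennreal) (auto intro!: mult_nonneg_nonneg)
    also have "(\<Sum>v\<in>?N. step (x m) v * ?c v) = sq_upto (Suc n) (x m)"
    proof -
      have "(\<Sum>v\<in>?N. step (x m) v * ?c v) = (\<Sum>v\<in>?N. step (x m) v) * (2 / ?r\<^sup>2)
          + (\<Sum>v\<in>?N. step (x m) v * (2 / ?r * mean_upto n (insert v (x m)) + sq_upto n (insert v (x m))))"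
        by (simp only: distrib_left sum.distrib sum_distrib_right)
      then show ?thesis using True sum_step[OF fin] by simp
    qed
    finally show ?thesis .
  qed
qed

section \<open>The hitting time from the origin\<close>

abbreviation start :: "nat \<Rightarrow> (int \<times> int) set" where
  "start \<equiv> \<lambda>_. {(0, 0)}"

lemma valid_start: "valid_path 0 start"
  by (simp add: valid_path_def)

lemma AE_start: "AE \<omega> in M. \<omega> \<in> path_event 0 start"
  using measure_path[of 0 start] path_event_measurable[OF valid_start]
  by (intro AE_in_set_eq_1[THEN iffD2]) auto

lemma nn_integral_start:
  "(\<integral>\<^sup>+\<omega>. indicator (path_event 0 start) \<omega> * F \<omega> \<partial>M) = (\<integral>\<^sup>+\<omega>. F \<omega> \<partial>M)"
  by (rule nn_integral_cong_AE, use AE_start in eventually_elim) simp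

lemma emeasure_start: "emeasure M (path_event 0 start) = 1"
  using measure_path[of 0 start] by (simp add: emeasure_eq_measure)

lemma expectation_time_to_hit: "(\<integral>\<^sup>+\<omega>. time_to_hit Z A n 0 \<omega> \<partial>M) = ennreal (mean_upto n {(0, 0)})"
  using nn_integral_time_to_hit[OF markov_weight_1 _ valid_start, of n] path_event_measurable[OF valid_start]
  by (simp add: nn_integral_start emeasure_start)

lemma expectation_time_to_hit_sq:
  "(\<integral>\<^sup>+\<omega>. (time_to_hit Z A n 0 \<omega>)\<^sup>2 \<partial>M) = ennreal (sq_upto n {(0, 0)})"
  using nn_integral_time_to_hit_sq[OF valid_start, of n] by (simp add: nn_integral_start emeasure_start)

lemma expectation_avoids: "(\<integral>\<^sup>+\<omega>. avoids Z A n 0 \<omega> \<partial>M) = ennreal (avoid_prob n {(0, 0)})"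
  using nn_integral_avoids[OF valid_start, of n] by (simp add: nn_integral_start emeasure_start)

text \<open>The infimum over \<open>n\<close> is the indicator of never meeting \<open>A\<close>;
  its integral lies below every \<open>avoid_prob\<close>, hence is 0.\<close>

lemma AE_eventually_hits: "AE \<omega> in M. \<exists>n. avoids Z A n 0 \<omega> = 0"
proof -
  have "(\<integral>\<^sup>+\<omega>. (INF n. avoids Z A n 0 \<omega>) \<partial>M) \<le> ennreal (avoid_prob n {(0, 0)})" for n
    unfolding expectation_avoids[symmetric] by (intro nn_integral_mono INF_lower) simp
  moreover have "(\<lambda>n. ennreal (avoid_prob n {(0, 0)})) \<longlonglongrightarrow> ennreal 0"
    by (intro tendsto_ennrealI avoid_prob_tendsto_0) simp
  ultimately have "(\<integral>\<^sup>+\<omega>. (INF n. avoids Z A n 0 \<omega>) \<partial>M) \<le> ennreal 0"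
    by (intro LIMSEQ_le_const) auto
  then have "AE \<omega> in M. (INF n. avoids Z A n 0 \<omega>) = 0"
    by (subst (asm) ennreal_0) (simp add: nn_integral_0_iff_AE)
  then show ?thesis
  proof eventually_elim
    case (elim \<omega>)
    show ?case
    proof (rule ccontr)
      assume "\<nexists>n. avoids Z A n 0 \<omega> = 0"
      then have "avoids Z A n 0 \<omega> = 1" for n using avoids_range[of Z A n 0 \<omega>] by auto
      with elim show False by simp
    qed
  qed
qed

lemma AE_time_to_hit_finite: "AE \<omega> in M. \<forall>n. time_to_hit Z A n 0 \<omega> \<noteq> \<infinity>"
  unfolding AE_all_countable
proof
  fix n
  have "(\<integral>\<^sup>+\<omega>. time_to_hit Z A n 0 \<omega> \<partial>M) \<noteq> \<infinity>" by (simp add: expectation_time_to_hit)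
  then show "AE \<omega> in M. time_to_hit Z A n 0 \<omega> \<noteq> \<infinity>" by (intro nn_integral_noteq_infinite) auto
qed

text \<open>If \<open>A\<close> is met at the \<open>k\<close>-th state, the truncated times are
  constant for \<open>n > k\<close>. Their finiteness makes the \<open>k\<close>-th jump time
  finite, so that it equals the hitting time.\<close>

lemma AE_hitting_time:
  "AE \<omega> in M. hitting_time Z A \<omega> < \<infinity> \<and> 0 \<le> hitting_time Z A \<omega> \<and>
     (SUP n. time_to_hit Z A n 0 \<omega>) = e2ennreal (hitting_time Z A \<omega>)"
  using AE_eventually_hits AE_time_to_hit_finite
proof eventually_elim
  case (elim \<omega>)
  then obtain n where "avoids Z A n 0 \<omega> = 0" by blast
  then obtain k where k: "\<And>j. j < k \<Longrightarrow> jump_chain Z j \<omega> \<inter> A = {}" "jump_chain Z k \<omega> \<inter> A \<noteq> {}"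
    by (rule avoids_eq_0D) auto
  have eq: "time_to_hit Z A n 0 \<omega> = e2ennreal (jump_time Z k \<omega>)" if "k < n" for n
    using jump_time_plus_time_to_hit[of k Z 0 \<omega> A n] k that by simp
  have "e2ennreal (jump_time Z k \<omega>) \<noteq> \<infinity>" using eq[of "Suc k"] elim(2) by (metis lessI)
  then have fin: "jump_time Z k \<omega> \<noteq> \<infinity>" by auto
  have T: "hitting_time Z A \<omega> = jump_time Z k \<omega>" by (rule hitting_time_eq_jump_time[OF k fin])
  have "incseq (\<lambda>n. time_to_hit Z A n 0 \<omega>)" by (rule incseq_SucI) (rule time_to_hit_mono)
  then have "(\<lambda>n. time_to_hit Z A n 0 \<omega>) \<longlonglongrightarrow> (SUP n. time_to_hit Z A n 0 \<omega>)"
    by (rule LIMSEQ_SUP)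
  moreover have "(\<lambda>n. time_to_hit Z A n 0 \<omega>) \<longlonglongrightarrow> e2ennreal (jump_time Z k \<omega>)"
    using eq by (intro tendsto_eventually eventually_sequentiallyI[of "Suc k"]) auto
  ultimately have "(SUP n. time_to_hit Z A n 0 \<omega>) = e2ennreal (jump_time Z k \<omega>)"
    by (rule LIMSEQ_unique)
  with T fin jump_time_nonneg[of Z k \<omega>] show ?case by (simp add: less_top[symmetric] top_ereal_def)
qed

definition hit_time :: "'w \<Rightarrow> real" where
  "hit_time \<omega> = real_of_ereal (hitting_time Z A \<omega>)"

lemma hit_time_measurable [measurable]: "hit_time \<in> borel_measurable M"
  unfolding hit_time_def using hitting_time_measurable[OF right_continuous_process_axioms] by measurable

lemma AE_hit_time: "AE \<omega> in M. 0 \<le> hit_time \<omega> \<and> (SUP n. time_to_hit Z A n 0 \<omega>) = ennreal (hit_time \<omega>)"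
  using AE_hitting_time
proof eventually_elim
  case (elim \<omega>)
  then show ?case by (cases "hitting_time Z A \<omega>") (auto simp: hit_time_def)
qed

lemma nn_integral_hit_time: "(\<integral>\<^sup>+\<omega>. ennreal (hit_time \<omega>) \<partial>M) = ennreal (mean_hit {(0, 0)})"
proof -
  have "(\<integral>\<^sup>+\<omega>. ennreal (hit_time \<omega>) \<partial>M) = (\<integral>\<^sup>+\<omega>. (SUP n. time_to_hit Z A n 0 \<omega>) \<partial>M)"
    by (rule nn_integral_cong_AE, use AE_hit_time in eventually_elim) simp
  also have "\<dots> = (SUP n. \<integral>\<^sup>+\<omega>. time_to_hit Z A n 0 \<omega> \<partial>M)"
    by (intro nn_integral_monotone_convergence_SUP incseq_SucI le_funI time_to_hit_mono) measurable
  also have "\<dots> = (SUP n. ennreal (mean_upto n {(0, 0)}))" by (simp add: expectation_time_to_hit)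
  also have "\<dots> = ennreal (mean_hit {(0, 0)})"
  proof (rule LIMSEQ_unique)
    show "(\<lambda>n. ennreal (mean_upto n {(0, 0)})) \<longlonglongrightarrow> (SUP n. ennreal (mean_upto n {(0, 0)}))"
      by (intro LIMSEQ_SUP incseq_SucI ennreal_leI mean_upto_mono) simp
    show "(\<lambda>n. ennreal (mean_upto n {(0, 0)})) \<longlonglongrightarrow> ennreal (mean_hit {(0, 0)})"
      by (intro tendsto_ennrealI mean_upto_tendsto) auto
  qed
  finally show ?thesis .
qed

lemma nn_integral_hit_time_sq_le:
  "(\<integral>\<^sup>+\<omega>. ennreal ((hit_time \<omega>)\<^sup>2) \<partial>M) \<le> ennreal ((mean_hit {(0, 0)})\<^sup>2 + mean_hit {(0, 0)} / c_low)"
proof -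
  have inc: "incseq (\<lambda>n. time_to_hit Z A n 0 \<omega>)" for \<omega>
    by (rule incseq_SucI) (rule time_to_hit_mono)
  have "(SUP n. time_to_hit Z A n 0 \<omega>)\<^sup>2 = (SUP n. (time_to_hit Z A n 0 \<omega>)\<^sup>2)" for \<omega>
  proof (rule LIMSEQ_unique)
    show "(\<lambda>n. (time_to_hit Z A n 0 \<omega>)\<^sup>2) \<longlonglongrightarrow> (SUP n. time_to_hit Z A n 0 \<omega>)\<^sup>2"
    proof -
      \<comment> \<open>Multiplication of extended reals is continuous away from zero times
        infinity, which a square never is.\<close>
      have "\<not> (s = 0 \<and> s = \<infinity> \<or> s = \<infinity> \<and> s = 0)" for s :: ennreal by auto
      then show ?thesis
        unfolding power2_eq_square by (intro tendsto_mult_ennreal LIMSEQ_SUP inc)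
    qed
    show "(\<lambda>n. (time_to_hit Z A n 0 \<omega>)\<^sup>2) \<longlonglongrightarrow> (SUP n. (time_to_hit Z A n 0 \<omega>)\<^sup>2)"
      by (intro LIMSEQ_SUP incseq_SucI power_mono time_to_hit_mono) simp
  qed
  note sq = this
  have "(\<integral>\<^sup>+\<omega>. ennreal ((hit_time \<omega>)\<^sup>2) \<partial>M) = (\<integral>\<^sup>+\<omega>. (SUP n. (time_to_hit Z A n 0 \<omega>)\<^sup>2) \<partial>M)"
  proof (intro nn_integral_cong_AE, use AE_hit_time in eventually_elim)
    case (elim \<omega>)
    then have "ennreal ((hit_time \<omega>)\<^sup>2) = (SUP n. time_to_hit Z A n 0 \<omega>)\<^sup>2"
      by (simp add: ennreal_power)
    then show ?case unfolding sq .
  qed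
  also have "\<dots> = (SUP n. \<integral>\<^sup>+\<omega>. (time_to_hit Z A n 0 \<omega>)\<^sup>2 \<partial>M)"
    by (intro nn_integral_monotone_convergence_SUP incseq_SucI le_funI power_mono time_to_hit_mono) simp_all
  also have "\<dots> = (SUP n. ennreal (sq_upto n {(0, 0)}))" by (simp add: expectation_time_to_hit_sq)
  also have "\<dots> \<le> ennreal ((mean_hit {(0, 0)})\<^sup>2 + mean_hit {(0, 0)} / c_low)"
    by (intro SUP_least ennreal_leI sq_upto_le) auto
  finally show ?thesis .
qed

text \<open>The mean is known exactly and not only up to a bound, so its square cancels in the
  variance and \<open>?h / c_low\<close> remains.\<close>

lemma hit_time_moments:
  "integrable M hit_time \<and> integrable M (\<lambda>\<omega>. (hit_time \<omega>)\<^sup>2) \<and> variance hit_time \<le> expectation hit_time / c_low"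
proof -
  let ?h = "mean_hit {(0, 0)}"
  have h: "0 \<le> ?h" by (intro mean_hit_nonneg) auto
  have nonneg: "AE \<omega> in M. 0 \<le> hit_time \<omega>" using AE_hit_time by eventually_elim simp
  have 1: "integrable M hit_time" "expectation hit_time = ?h"
    using integrableI_nn_integral_finite[OF hit_time_measurable nonneg nn_integral_hit_time]
      integral_eq_nn_integral[OF hit_time_measurable nonneg] nn_integral_hit_time h by simp_all
  have 2: "integrable M (\<lambda>\<omega>. (hit_time \<omega>)\<^sup>2)"
    using nn_integral_hit_time_sq_le by (intro integrableI_nonneg) (auto intro: le_less_trans)
  have "expectation (\<lambda>\<omega>. (hit_time \<omega>)\<^sup>2) \<le> ?h\<^sup>2 + ?h / c_low"
  proof (subst ennreal_le_iff[symmetric])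
    show "ennreal (expectation (\<lambda>\<omega>. (hit_time \<omega>)\<^sup>2)) \<le> ennreal (?h\<^sup>2 + ?h / c_low)"
      using nn_integral_hit_time_sq_le nn_integral_eq_integral[OF 2] by (simp del: ennreal_plus)
  qed (use h c_pos in simp)
  then have "variance hit_time \<le> ?h / c_low" using variance_eq[OF 1(1) 2] 1(2) by simp
  with 1 2 show ?thesis by simp
qed

end

theorem proposition3:
  fixes M :: "'w measure"
    and Z :: "real \<Rightarrow> 'w \<Rightarrow> (int \<times> int) set"
    and q :: "(int \<times> int) set \<Rightarrow> (int \<times> int) set \<Rightarrow> real"
    and c_low c_up :: real
    and A :: "(int \<times> int) set"
  assumes chain: "markov_chain M {S. finite S} q {(0, 0)} Z"
    and transitions: "\<And>S S'. finite S \<Longrightarrow> finite S' \<Longrightarrow> S' \<noteq> S \<Longrightarrow>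
           \<not> (\<exists>v. adjacent v S \<and> S' = S \<union> {v}) \<Longrightarrow> q S S' = 0"
    and c_pos: "0 < c_low"
    and rate_bounds: "\<And>S v. finite S \<Longrightarrow> adjacent v S \<Longrightarrow>
           c_low \<le> q S (S \<union> {v}) \<and> q S (S \<union> {v}) \<le> c_up"
    and rate_mono: "\<And>S v v'. finite S \<Longrightarrow> adjacent v S \<Longrightarrow> adjacent v' S \<Longrightarrow> v \<noteq> v' \<Longrightarrow>
           q S (S \<union> {v}) \<le> q (S \<union> {v'}) (S \<union> {v, v'})"
    and A_nonempty: "A \<noteq> {}"
    and A_origin: "A \<subseteq> UNIV - {(0, 0)}"
  defines "T \<equiv> hitting_time Z A"
  shows "(AE \<omega> in M. T \<omega> < \<infinity>) \<and>
         integrable M (\<lambda>\<omega>. real_of_ereal (T \<omega>)) \<and>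
         integrable M (\<lambda>\<omega>. (real_of_ereal (T \<omega>))\<^sup>2) \<and>
         prob_space.variance M (\<lambda>\<omega>. real_of_ereal (T \<omega>))
           \<le> prob_space.expectation M (\<lambda>\<omega>. real_of_ereal (T \<omega>)) / c_low"
proof -
  have "growth_rates q c_low c_up A"
    using c_pos rate_bounds rate_mono A_nonempty by (simp add: growth_rates_def insert_commute)
  moreover have "markov_jump_process M {S. finite S} q {(0, 0)} Z"
    using chain countable_Collect_finite by (simp add: markov_jump_process_def)
  moreover have "growth_process_axioms q"
    using transitions by (simp add: growth_process_axioms_def)
  ultimately interpret growth_process q c_low c_up A M Z
    by (rule growth_process.intro)
  have "AE \<omega> in M. T \<omega> < \<infinity>"
    unfolding T_def using AE_hitting_time by eventually_elim simp
  with hit_time_moments show ?thesis unfolding T_def hit_time_def by simp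
qed

end
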